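(* Let $\mathcal X=\mathbb R^n$ (unconstrained case), let $f$ be $\rho$-smooth and let Assumptions (A1) and (A3) (stated in the context) hold. Let $\lambda^{-1}\in(3\rho/2,2\rho]$. Fix an integer $K\ge0$ and $\alpha_0\in(0,1/(4\rho)]$, and run the stochastic heavy ball method described in the context with $\alpha=\frac{\alpha_0}{\sqrt{K+1}}$, $\nu=1/\alpha_0$ and $\beta=\nu\alpha$. Let $k^*$ be sampled uniformly at random from $\{-1,\ldots,K-1\}$, let $f^\star=\inf_{x}f(x)$ and $\Delta=f(x_0)-f^\star$. Then $$\mathbb E\left[\|\nabla F_\lambda(\bar x_{k^*})\|_2^2\right]\le c\cdot\frac{(1+2\alpha_0^2/\lambda^2)\Delta+\frac{(1+8\alpha_0/\lambda)\sigma^2\alpha_0^2}{2\lambda}}{\alpha_0\sqrt{K+1}},\qquad c=\frac{2\lambda^{-1}}{2\lambda^{-1}-3\rho}.$$ Furthermore, for $\lambda=1/(2\rho)$, $$\mathbb E\left[\|\nabla F_{1/(2\rho)}(\bar x_{k^*})\|_2^2\right]\le 4\cdot\frac{(1+8\rho^2\alpha_0^2)\Delta+(\rho+16\alpha_0\rho^2)\sigma^2\alpha_0^2}{\alpha_0\sqrt{K+1}}.$$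
   Context: Problem: minimize $f(x)=\mathbb E_P[f(x;S)]$ over $x\in\mathbb R^n$, where $S\sim P$ is a random variable on a probability space $(\mathcal S,\mathcal F,P)$. The function $f$ is $\rho$-smooth ($\rho>0$): it is differentiable and $\|\nabla f(x)-\nabla f(y)\|_2\le\rho\|x-y\|_2$ for all $x,y$. $\partial f(x,s)$ is the Fréchet subdifferential of $f(\cdot;s)$ at $x$ (the set of $g$ with $f(y;s)\ge f(x;s)+\langle g,y-x\rangle+o(\|y-x\|)$ as $y\to x$), and $f'(x,S)\in\partial f(x,S)$ denotes the stochastic (sub)gradient returned by the oracle. (A1) For each $x$, $\mathbb E_P[f'(x,S)]=\nabla f(x)$. (A3) There is a real $\sigma>0$ such that $\mathbb E[\|f'(x,S)-\nabla f(x)\|_2^2]\le\sigma^2$ for all $x$. Stochastic heavy ball method: let $S_0,S_1,\ldots$ be i.i.d. from $P$ and $g_k=f'(x_k,S_k)\in\partial f(x_k,S_k)$. With stepsize $\alpha>0$ and momentum parameter $\beta\in(0,1]$, start from $x_0\in\mathbb R^n$, $z_0=g_0\in\partial f(x_0,S_0)$ and for $k=0,1,2,\ldots$ set $$x_{k+1}=x_k-\alpha z_k,\qquad z_{k+1}=\beta g_{k+1}+(1-\beta)\frac{x_k-x_{k+1}}{\alpha}.$$ Define $\bar x_k=x_k+\frac{1-\beta}{\beta}(x_k-x_{k-1})$ for $k\ge0$, with the conventions $x_{-1}=x_0$ and $\bar x_{-1}=\bar x_0=x_0$. Since $\mathcal X=\mathbb R^n$, $F=f$; the Moreau envelope is $F_\lambda(x)=\inf_{y\in\mathbb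 R^n}\{f(y)+\frac1{2\lambda}\|x-y\|_2^2\}$, which here is continuously differentiable with $\nabla F_\lambda(x)=\lambda^{-1}(x-\hat x)$, where $\hat x$ is the unique minimizer in the definition of $F_\lambda(x)$. *)

theory Defs
  imports "HOL-Probability.Probability" "HOL-Library.Landau_Symbols"
begin

text \<open>The gradient is meaningful only where the function is differentiable; it is then the
  unique vector representing the derivative.\<close>

definition gradient :: "(real ^ 'n \<Rightarrow> real) \<Rightarrow> real ^ 'n \<Rightarrow> real ^ 'n" where
  "gradient f x = (THE D. GDERIV f x :> D)"

definition smooth_fun :: "real \<Rightarrow> (real ^ 'n \<Rightarrow> real) \<Rightarrow> bool" where
  "smooth_fun \<rho> f \<longleftrightarrow>
     (\<forall>x. f differentiable (at x)) \<and>
     (\<forall>x y. norm (gradient f x - gradient f y) \<le> \<rho> * norm (x - y))"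

definition frechet_subdifferential :: "(real ^ 'n \<Rightarrow> real) \<Rightarrow> real ^ 'n \<Rightarrow> (real ^ 'n) set" where
  "frechet_subdifferential f x =
     {g. \<exists>r. r \<in> o[at x](\<lambda>y. norm (y - x)) \<and>
             (\<forall>\<^sub>F y in at x. f y \<ge> f x + g \<bullet> (y - x) + r y)}"

text \<open>The infimum is taken in the reals. It is the intended one whenever the function in braces
  is bounded below, as it is for a \<open>\<rho>\<close>-smooth \<open>f\<close> and \<open>0 < lam < 1 / \<rho>\<close>.\<close>

definition moreau_envelope :: "real \<Rightarrow> (real ^ 'n \<Rightarrow> real) \<Rightarrow> real ^ 'n \<Rightarrow> real" where
  "moreau_envelope lam f x = (INF y. f y + 1 / (2 * lam) * (norm (x - y))\<^sup>2)"

text \<open>The extrapolated iterates are indexed by the integers \<open>k \<ge> -1\<close>. The values at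
  \<open>k = -1\<close> and \<open>k = 0\<close> are both \<open>x\<^sub>0\<close>, by the convention \<open>x\<^bsub>-1\<^esub> = x\<^sub>0\<close>.\<close>

definition extrapolated :: "real \<Rightarrow> (nat \<Rightarrow> real ^ 'n) \<Rightarrow> int \<Rightarrow> real ^ 'n" where
  "extrapolated \<beta> x k =
     (if k \<le> 0 then x 0
      else x (nat k) + ((1 - \<beta>) / \<beta>) *\<^sub>R (x (nat k) - x (nat (k - 1))))"

text \<open>The infimum is taken in the extended reals, so the gap is \<open>\<infinity>\<close> when \<open>f\<close> is
  unbounded below.\<close>

definition optimality_gap :: "(real ^ 'n \<Rightarrow> real) \<Rightarrow> real ^ 'n \<Rightarrow> ereal" where
  "optimality_gap f x = ereal (f x) - (INF y. ereal (f y))"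

end

theory Submission
  imports Defs
begin

text \<open>
  The extrapolated points satisfy \<open>u\<^sub>k\<^sub>+\<^sub>1 = u\<^sub>k - \<alpha> g\<^sub>k\<close> for \<open>k \<ge> 1\<close>
  (\<open>xbar_Suc\<close>; \<open>u\<^sub>k\<close> stands for \<open>xbar k\<close>): they perform stochastic gradient steps, but with
  gradients sampled at \<open>x\<^sub>k\<close>. The displacement \<open>x\<^sub>k - u\<^sub>k = \<alpha>\<^sub>0 (1 - \<beta>) z\<^sub>k\<^sub>-\<^sub>1\<close> is a multiple of the previous momentum
  vector. The first step is exceptional: since \<open>z\<^sub>0 = g\<^sub>0\<close> rather than \<open>\<beta> g\<^sub>0\<close>, it has length \<open>\<alpha>\<^sub>0\<close>
  and carries about as much noise as all later steps together.

  The Moreau envelope has the quadratic upper model of \<open>moreau_descent\<close>, so a step from \<open>u\<^sub>k\<close> decreases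
  it in expectation by \<open>\<alpha> E(\<nabla>F\<^sub>\<lambda>(u\<^sub>k) \<bullet> \<nabla>f(x\<^sub>k))\<close>, up to second order terms
  (\<open>expected_descent\<close>). If \<open>\<nabla>f\<close> were evaluated at \<open>u\<^sub>k\<close>, this inner product would be at least
  \<open>(1 - \<rho> \<lambda>) |\<nabla>F\<^sub>\<lambda>(u\<^sub>k)|\<^sup>2\<close> (\<open>inner_grad_env_gradient_ge\<close>); the displacement costs a multiple of \<open>|z\<^sub>k\<^sub>-\<^sub>1|\<^sup>2\<close>
  (\<open>envelope_step\<close>). Two auxiliary sums are therefore needed. Momentum is an averaging process, so
  \<open>\<Sum> E |z\<^sub>k|\<^sup>2\<close> is bounded by \<open>\<Sum> E |\<nabla>f(x\<^sub>k)|\<^sup>2\<close> plus noise (\<open>momentum_sum\<close>); and the descent of \<open>f\<close> itself along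
  the \<open>u\<^sub>k\<close> bounds \<open>\<Sum> E |\<nabla>f(x\<^sub>k)|\<^sup>2\<close> by the gap, noise and a small multiple of \<open>\<Sum> E |z\<^sub>k|\<^sup>2\<close> (\<open>objective_sum\<close>). The
  condition \<open>\<alpha>\<^sub>0 \<le> 1/(4 \<rho>)\<close> closes this loop (\<open>momentum_energy_bounds\<close>).

  The constants work out because the envelope decreases at the rate \<open>1 - \<rho> \<lambda>\<close>, while the claim only asks for
  \<open>1/c = 1 - 3 \<rho> \<lambda> / 2\<close>. This surplus pays for the noise of the long first step, for the two copies of \<open>x\<^sub>0\<close>
  among the averaged points and for the displacement (\<open>envelope_energy_bound\<close>). In the limit \<open>\<alpha>\<^sub>0 \<rightarrow> 0\<close> and at
  \<open>\<lambda> = 1/(2 \<rho>)\<close> this accounting of the noise leaves no room.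

  The expectations rest on one probabilistic fact: \<open>x\<^sub>k\<close> and \<open>z\<^sub>k\<^sub>-\<^sub>1\<close> are functions of the samples before \<open>S\<^sub>k\<close>, so
  the noise \<open>g\<^sub>k - \<nabla>f(x\<^sub>k)\<close> is orthogonal to everything built from them (\<open>noise_orthogonal\<close>). Likewise the
  random index is independent of all samples, so the expectation at the random point is the plain average over
  the \<open>K + 1\<close> indices (\<open>expectation_at_random_index\<close>).
\<close>

section \<open>Gradients of smooth functions\<close>

lemma gradient_eqI:
  assumes "GDERIV h u :> D"
  shows "gradient h u = D"
proof -
  have "D' = D" if "GDERIV h u :> D'" for D'
  proof -
    have "(\<lambda>v. v \<bullet> D') = (\<lambda>v. v \<bullet> D)"
      using that assms unfolding gderiv_def by (rule has_derivative_unique)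
    then show ?thesis by (metis inner_commute vector_eq_rdot)
  qed
  then show ?thesis unfolding gradient_def using assms by blast
qed

lemma GDERIV_gradient:
  fixes h :: "real ^ 'n \<Rightarrow> real"
  assumes "h differentiable (at u)"
  shows "GDERIV h u :> gradient h u"
proof -
  obtain h' where h': "(h has_derivative h') (at u)"
    using assms unfolding differentiable_def by blast
  have "h' v = v \<bullet> adjoint h' 1" for v
    using adjoint_works[of h' v 1] h' has_derivative_linear by fastforce
  then have "h' = (\<lambda>v. v \<bullet> adjoint h' 1)" by blast
  with h' have "GDERIV h u :> adjoint h' 1" unfolding gderiv_def by simp
  then show ?thesis using gradient_eqI by metis
qed

lemma continuous_on_norm_lipschitz:
  fixes h :: "'a::real_normed_vector \<Rightarrow> 'b::real_normed_vector"
  assumes h: "\<And>u v. norm (h u - h v) \<le> C * norm (u - v)"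
  shows "continuous_on A h"
proof (rule lipschitz_on_continuous_on[where L = "\<bar>C\<bar>"], rule lipschitz_onI)
  fix u v
  show "dist (h u) (h v) \<le> \<bar>C\<bar> * dist u v"
    using h[of u v] mult_right_mono[OF abs_ge_self[of C], of "norm (u - v)"] by (simp add: dist_norm)
qed simp

locale smooth_objective =
  fixes f :: "real ^ 'n \<Rightarrow> real" and \<rho> :: real
  assumes rho: "\<rho> > 0" and smooth: "smooth_fun \<rho> f"
begin

lemma gradient_lipschitz: "norm (gradient f u - gradient f v) \<le> \<rho> * norm (u - v)"
  using smooth unfolding smooth_fun_def by blast

lemma GDERIV_f: "GDERIV f u :> gradient f u"
  using smooth unfolding smooth_fun_def by (blast intro: GDERIV_gradient)

text \<open>Along the segment from \<open>u\<close> to \<open>v\<close> the derivative of \<open>f\<close> differs from its initial value by at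
  most \<open>\<rho> t |v - u|\<^sup>2\<close>. So \<open>\<plusminus>f\<close>, corrected by its linear part and the quadratic
  \<open>\<rho>/2 t\<^sup>2 |v - u|\<^sup>2\<close>, is nonincreasing in \<open>t\<close>; the sign \<open>s\<close> in the proof treats both bounds at once.\<close>

lemma taylor_bound: "\<bar>f v - f u - gradient f u \<bullet> (v - u)\<bar> \<le> \<rho> / 2 * (norm (v - u))\<^sup>2"
proof -
  define d where "d = v - u"
  have der: "((\<lambda>t. f (u + t *\<^sub>R d)) has_real_derivative gradient f (u + t *\<^sub>R d) \<bullet> d) (at t)" for t
  proof -
    have "(f has_derivative (\<lambda>h. h \<bullet> gradient f (u + t *\<^sub>R d))) (at (u + t *\<^sub>R d))"
      using GDERIV_f unfolding gderiv_def by blast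
    moreover have "((\<lambda>t. u + t *\<^sub>R d) has_derivative (\<lambda>h. h *\<^sub>R d)) (at t)"
      by (auto intro!: derivative_eq_intros)
    ultimately have "((\<lambda>t. f (u + t *\<^sub>R d)) has_derivative
        (\<lambda>h. (h *\<^sub>R d) \<bullet> gradient f (u + t *\<^sub>R d))) (at t)"
      by (rule has_derivative_compose[rotated])
    moreover have "(\<lambda>h. (h *\<^sub>R d) \<bullet> gradient f (u + t *\<^sub>R d)) = (*) (gradient f (u + t *\<^sub>R d) \<bullet> d)"
      by (auto simp: fun_eq_iff inner_commute)
    ultimately show ?thesis by (simp add: has_field_derivative_def)
  qed
  have bound: "\<bar>(gradient f (u + t *\<^sub>R d) - gradient f u) \<bullet> d\<bar> \<le> \<rho> * t * (norm d)\<^sup>2" if "t \<ge> 0" for t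
  proof -
    have "\<bar>(gradient f (u + t *\<^sub>R d) - gradient f u) \<bullet> d\<bar>
        \<le> norm (gradient f (u + t *\<^sub>R d) - gradient f u) * norm d"
      by (rule Cauchy_Schwarz_ineq2)
    also have "\<dots> \<le> (\<rho> * norm (u + t *\<^sub>R d - u)) * norm d"
      by (intro mult_right_mono gradient_lipschitz) auto
    finally show ?thesis using that by (simp add: power2_eq_square)
  qed
  define up where "up s t = s * (f (u + t *\<^sub>R d) - t * (gradient f u \<bullet> d)) - \<rho> / 2 * t\<^sup>2 * (norm d)\<^sup>2"
    for s t :: real
  have "up s 1 \<le> up s 0" if s: "s = 1 \<or> s = -1" for s
  proof (rule DERIV_nonpos_imp_nonincreasing[where f = "up s" and a = 0 and b = 1])
    fix t :: real assume t: "0 \<le> t"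
    have "(up s has_real_derivative
        s * ((gradient f (u + t *\<^sub>R d) - gradient f u) \<bullet> d) - \<rho> * t * (norm d)\<^sup>2) (at t)"
      unfolding up_def by (auto intro!: derivative_eq_intros der simp: inner_diff_left)
    moreover have "s * ((gradient f (u + t *\<^sub>R d) - gradient f u) \<bullet> d) - \<rho> * t * (norm d)\<^sup>2 \<le> 0"
      using bound[OF t] s by (auto simp: abs_le_iff)
    ultimately show "\<exists>y. (up s has_real_derivative y) (at t) \<and> y \<le> 0" by blast
  qed simp
  moreover have "up s 1 = s * (f v - gradient f u \<bullet> d) - \<rho> / 2 * (norm d)\<^sup>2" "up s 0 = s * f u" for s
    by (simp_all add: up_def d_def)
  ultimately have le: "s * (f v - gradient f u \<bullet> d) - \<rho> / 2 * (norm d)\<^sup>2 \<le> s * f u"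
    if "s = 1 \<or> s = -1" for s
    using that by metis
  define b i where "b = \<rho> / 2 * (norm d)\<^sup>2" and "i = gradient f u \<bullet> d"
  have "f v - i \<le> f u + b" and "f u \<le> f v - i + b"
    using le[of 1] le[of "-1"] unfolding b_def i_def by simp_all
  then have "\<bar>f v - f u - i\<bar> \<le> b" by linarith
  then show ?thesis unfolding b_def i_def d_def .
qed

lemma descent: "f v \<le> f u + gradient f u \<bullet> (v - u) + \<rho> / 2 * (norm (v - u))\<^sup>2"
  using taylor_bound[of v u] by linarith

lemma continuous_gradient: "continuous_on A (gradient f)"
  by (rule continuous_on_norm_lipschitz[OF gradient_lipschitz])

lemma continuous_f: "continuous_on A f"
  using GDERIV_f unfolding gderiv_def
  by (meson continuous_at_imp_continuous_on has_derivative_continuous)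

text \<open>One gradient step of length \<open>1/\<rho>\<close> already decreases \<open>f\<close> by \<open>|\<nabla>f|\<^sup>2 / (2 \<rho>)\<close>.\<close>

lemma gradient_sq_le_gap:
  assumes "\<And>v. m \<le> f v"
  shows "(norm (gradient f u))\<^sup>2 \<le> 2 * \<rho> * (f u - m)"
proof -
  define v where "v = u - (1 / \<rho>) *\<^sub>R gradient f u"
  have "m \<le> f u + gradient f u \<bullet> (v - u) + \<rho> / 2 * (norm (v - u))\<^sup>2"
    using assms[of v] descent[of v u] by linarith
  also have "\<dots> = f u - (norm (gradient f u))\<^sup>2 / (2 * \<rho>)"
    using rho by (simp add: v_def power_mult_distrib power2_norm_eq_inner field_simps)
      (simp add: power2_eq_square)
  finally show ?thesis using rho by (simp add: field_simps)
qed

end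

section \<open>The Moreau envelope of a smooth function\<close>

locale smooth_moreau = smooth_objective f \<rho> for f :: "real ^ 'n \<Rightarrow> real" and \<rho> +
  fixes lam :: real
  assumes lam: "lam > 0" "\<rho> * lam < 1"
begin

text \<open>For smooth \<open>f\<close> with \<open>\<rho> \<lambda> < 1\<close>, minimizers of \<open>f(y) + |u - y|\<^sup>2 / (2 \<lambda>)\<close> are exactly the
  stationary points. Taking the stationarity equation as definition turns existence, uniqueness
  and Lipschitz dependence on \<open>u\<close> into properties of a contraction.\<close>

definition prox :: "real ^ 'n \<Rightarrow> real ^ 'n" where
  "prox u = (THE y. y = u - lam *\<^sub>R gradient f y)"

lemma prox_fixpoint: "prox u = u - lam *\<^sub>R gradient f (prox u)"
proof -
  have "\<exists>!y\<in>UNIV. u - lam *\<^sub>R gradient f y = y"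
  proof (rule Banach_fix)
    show "dist (u - lam *\<^sub>R gradient f y) (u - lam *\<^sub>R gradient f y') \<le> (\<rho> * lam) * dist y y'" for y y'
    proof -
      have "dist (u - lam *\<^sub>R gradient f y) (u - lam *\<^sub>R gradient f y')
          = lam * norm (gradient f y - gradient f y')"
        using lam by (simp add: dist_norm norm_minus_commute flip: scaleR_diff_right)
      then show ?thesis
        using gradient_lipschitz[of y y'] lam by (simp add: dist_norm mult.assoc mult.left_commute)
    qed
  qed (use rho lam in \<open>auto simp: complete_UNIV\<close>)
  then have "\<exists>!y. y = u - lam *\<^sub>R gradient f y" by (metis UNIV_I)
  then show ?thesis unfolding prox_def by (rule theI')
qed

text \<open>The gradient of the envelope: by stationarity this vector equals \<open>(u - prox u) / \<lambda>\<close>.\<close>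

definition grad_env :: "real ^ 'n \<Rightarrow> real ^ 'n" where
  "grad_env u = gradient f (prox u)"

lemma diff_prox: "u - prox u = lam *\<^sub>R grad_env u"
  using prox_fixpoint[of u] by (simp add: grad_env_def algebra_simps)

text \<open>By the lower Taylor bound \<open>f\<close> curves downward by at most \<open>\<rho>\<close>, and the quadratic penalty curves
  upward by \<open>1/\<lambda> > \<rho>\<close>; hence the stationary point is a global minimizer.\<close>

lemma moreau_le: "f (prox u) + 1 / (2 * lam) * (norm (u - prox u))\<^sup>2
    \<le> f y + 1 / (2 * lam) * (norm (u - y))\<^sup>2"
proof -
  define e where "e = y - prox u"
  define D where "D = grad_env u"
  have up: "u - prox u = lam *\<^sub>R D" unfolding D_def by (rule diff_prox)
  have uy: "u - y = lam *\<^sub>R D - e" using up by (simp add: e_def algebra_simps)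
  have 1: "f (prox u) + D \<bullet> e - \<rho> / 2 * (norm e)\<^sup>2 \<le> f y"
    using taylor_bound[of y "prox u"] unfolding D_def e_def grad_env_def by linarith
  have 2: "1 / (2 * lam) * (norm (u - y))\<^sup>2
      = 1 / (2 * lam) * (norm (u - prox u))\<^sup>2 - D \<bullet> e + 1 / (2 * lam) * (norm e)\<^sup>2"
    unfolding up uy power2_norm_eq_inner inner_diff_left inner_diff_right using lam
    by (simp add: inner_commute field_simps power2_eq_square)
  have "\<rho> / 2 \<le> 1 / (2 * lam)" using lam by (simp add: field_simps)
  then have "\<rho> / 2 * (norm e)\<^sup>2 \<le> 1 / (2 * lam) * (norm e)\<^sup>2" by (rule mult_right_mono) simp
  with 1 2 show ?thesis by linarith
qed

lemma moreau_eq: "moreau_envelope lam f u = f (prox u) + 1 / (2 * lam) * (norm (u - prox u))\<^sup>2"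
  unfolding moreau_envelope_def
  by (rule cInf_eq_minimum) (use moreau_le in auto)

lemma moreau_le_at: "moreau_envelope lam f u \<le> f y + 1 / (2 * lam) * (norm (u - y))\<^sup>2"
  unfolding moreau_eq by (rule moreau_le)

lemma moreau_le_f: "moreau_envelope lam f u \<le> f u"
  using moreau_le_at[of u u] by simp

lemma prox_lipschitz: "(1 - \<rho> * lam) * norm (prox u - prox v) \<le> norm (u - v)"
proof -
  have "prox u - prox v = (u - v) - lam *\<^sub>R (gradient f (prox u) - gradient f (prox v))"
    using prox_fixpoint[of u] prox_fixpoint[of v] by (simp add: algebra_simps)
  then have "norm (prox u - prox v)
      \<le> norm (u - v) + lam * norm (gradient f (prox u) - gradient f (prox v))"
    using norm_triangle_ineq4[of "u - v" "lam *\<^sub>R (gradient f (prox u) - gradient f (prox v))"] lam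
    by simp
  also have "\<dots> \<le> norm (u - v) + lam * (\<rho> * norm (prox u - prox v))"
    using gradient_lipschitz lam by (intro add_left_mono mult_left_mono) auto
  finally show ?thesis by (simp add: algebra_simps)
qed

lemma grad_env_lipschitz:
  "norm (grad_env u - grad_env v) \<le> \<rho> / (1 - \<rho> * lam) * norm (u - v)"
proof -
  have "norm (grad_env u - grad_env v) \<le> \<rho> * norm (prox u - prox v)"
    unfolding grad_env_def by (rule gradient_lipschitz)
  also have "norm (prox u - prox v) \<le> norm (u - v) / (1 - \<rho> * lam)"
    using prox_lipschitz[of u v] lam by (simp add: pos_le_divide_eq mult.commute)
  finally show ?thesis using rho by simp
qed

text \<open>Compare with the minimizer belonging to \<open>u\<close>: it remains admissible in the infimum at \<open>v\<close>.
  The envelope thus has an upper quadratic model of curvature \<open>1/\<lambda>\<close> even where \<open>f\<close> is not convex.\<close>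

lemma moreau_descent: "moreau_envelope lam f v
    \<le> moreau_envelope lam f u + grad_env u \<bullet> (v - u) + (1 / lam) / 2 * (norm (v - u))\<^sup>2"
proof -
  have eq: "v - prox u = (v - u) + lam *\<^sub>R grad_env u" using diff_prox[of u] by (simp add: algebra_simps)
  have "f (prox u) + 1 / (2 * lam) * (norm (v - prox u))\<^sup>2
      = moreau_envelope lam f u + grad_env u \<bullet> (v - u) + (1 / lam) / 2 * (norm (v - u))\<^sup>2"
    unfolding moreau_eq eq diff_prox power2_norm_eq_inner inner_add_left inner_add_right using lam
    by (simp add: inner_commute field_simps power2_eq_square)
  then show ?thesis using moreau_le_at[of v "prox u"] by linarith
qed

text \<open>The lower bound follows from the descent inequality with the roles of the points exchanged, as
  the gradient field is Lipschitz.\<close>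

lemma moreau_taylor_bound:
  "\<bar>moreau_envelope lam f v - moreau_envelope lam f u - (v - u) \<bullet> grad_env u\<bar>
    \<le> (\<rho> / (1 - \<rho> * lam) + (1 / lam) / 2) * (norm (v - u))\<^sup>2"
  (is "\<bar>?E v - ?E u - _\<bar> \<le> ?C * _")
proof -
  have p: "\<rho> / (1 - \<rho> * lam) * (norm (v - u))\<^sup>2 \<ge> 0" using rho lam by simp
  have "\<bar>(grad_env v - grad_env u) \<bullet> (v - u)\<bar> \<le> norm (grad_env v - grad_env u) * norm (v - u)"
    by (rule Cauchy_Schwarz_ineq2)
  also have "\<dots> \<le> \<rho> / (1 - \<rho> * lam) * norm (v - u) * norm (v - u)"
    by (intro mult_right_mono grad_env_lipschitz) auto
  finally have c: "\<bar>(grad_env v - grad_env u) \<bullet> (v - u)\<bar> \<le> \<rho> / (1 - \<rho> * lam) * (norm (v - u))\<^sup>2"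
    by (simp add: power2_eq_square)
  have "?E u \<le> ?E v - grad_env v \<bullet> (v - u) + (1 / lam) / 2 * (norm (v - u))\<^sup>2"
    using moreau_descent[of u v] by (simp add: inner_diff_right norm_minus_commute)
  moreover have "grad_env v \<bullet> (v - u) = (v - u) \<bullet> grad_env u + (grad_env v - grad_env u) \<bullet> (v - u)"
    by (simp add: inner_commute inner_diff_left inner_diff_right)
  ultimately show ?thesis
    using moreau_descent[of v u] c p inner_commute[of "v - u" "grad_env u"]
    unfolding distrib_right abs_le_iff by linarith
qed

lemma GDERIV_moreau: "GDERIV (moreau_envelope lam f) u :> grad_env u"
proof -
  let ?E = "moreau_envelope lam f"
  define C where "C = \<rho> / (1 - \<rho> * lam) + (1 / lam) / 2"
  have bd: "\<bar>?E v - ?E u - (v - u) \<bullet> grad_env u\<bar> \<le> C * (norm (v - u))\<^sup>2" for v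
    unfolding C_def by (rule moreau_taylor_bound)
  have "((\<lambda>v. (?E v - ?E u - (v - u) \<bullet> grad_env u) /\<^sub>R norm (v - u)) \<longlongrightarrow> 0) (at u)"
  proof (rule Lim_null_comparison)
    show "\<forall>\<^sub>F v in at u. norm ((?E v - ?E u - (v - u) \<bullet> grad_env u) /\<^sub>R norm (v - u)) \<le> C * norm (v - u)"
      using bd by (auto intro!: eventually_at_filter[THEN iffD2] always_eventually
          simp: divide_simps power2_eq_square mult.assoc abs_mult)
    have "((\<lambda>v. C * norm (v - u)) \<longlongrightarrow> C * norm (u - u)) (at u)" by (intro tendsto_intros)
    then show "((\<lambda>v. C * norm (v - u)) \<longlongrightarrow> 0) (at u)" by simp
  qed
  then show ?thesis
    unfolding gderiv_def has_derivative_at_within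
    by (simp add: bounded_linear_inner_left)
qed

lemma gradient_moreau: "gradient (moreau_envelope lam f) u = grad_env u"
  using GDERIV_moreau by (rule gradient_eqI)

lemma continuous_moreau: "continuous_on A (moreau_envelope lam f)"
  using GDERIV_moreau unfolding gderiv_def
  by (meson continuous_at_imp_continuous_on has_derivative_continuous)

text \<open>\<open>\<nabla>F\<^sub>\<lambda>(u)\<close> is the gradient of \<open>f\<close> at a point at distance \<open>\<lambda> |\<nabla>F\<^sub>\<lambda>(u)|\<close> from \<open>u\<close>, so it differs from
  \<open>\<nabla>f(u)\<close> by at most a fraction \<open>\<rho> \<lambda>\<close> of its own length. A gradient step for \<open>f\<close> is therefore a descent
  step for the envelope.\<close>

lemma inner_grad_env_gradient_ge:
  "(1 - \<rho> * lam) * (norm (grad_env u))\<^sup>2 \<le> grad_env u \<bullet> gradient f u"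
proof -
  have "\<bar>grad_env u \<bullet> (grad_env u - gradient f u)\<bar>
      \<le> norm (grad_env u) * norm (gradient f (prox u) - gradient f u)"
    unfolding grad_env_def by (rule Cauchy_Schwarz_ineq2)
  also have "\<dots> \<le> norm (grad_env u) * (\<rho> * norm (u - prox u))"
    using gradient_lipschitz[of "prox u" u] by (intro mult_left_mono) (auto simp: norm_minus_commute)
  also have "\<dots> = \<rho> * lam * (norm (grad_env u))\<^sup>2"
    unfolding diff_prox using lam by (simp add: power2_eq_square)
  finally show ?thesis
    by (simp add: inner_diff_right power2_norm_eq_inner algebra_simps)
qed

text \<open>Combines the drop from \<open>f(u)\<close> to \<open>f\<close> at the proximal point with the gradient step that can still
  be made from there. It makes the two copies of \<open>x\<^sub>0\<close> among the averaged points cheap.\<close>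

lemma grad_env_sq_le_gap:
  assumes "\<And>v. m \<le> f v"
  shows "(1 + \<rho> * lam) * (norm (grad_env u))\<^sup>2 \<le> 2 * \<rho> * (f u - m)"
proof -
  have "f (prox u) + lam / 2 * (norm (grad_env u))\<^sup>2 \<le> f u"
    using moreau_le_f[of u] lam unfolding moreau_eq diff_prox
    by (simp add: power_mult_distrib power2_eq_square mult_ac)
  from mult_left_mono[OF this, of "2 * \<rho>"]
  have "2 * \<rho> * f (prox u) + \<rho> * lam * (norm (grad_env u))\<^sup>2 \<le> 2 * \<rho> * f u"
    using rho by (simp add: algebra_simps)
  moreover have "(norm (grad_env u))\<^sup>2 \<le> 2 * \<rho> * (f (prox u) - m)"
    unfolding grad_env_def by (rule gradient_sq_le_gap) (rule assms)
  ultimately show ?thesis by (simp add: algebra_simps)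
qed

end

section \<open>Square-integrable random vectors\<close>

definition sq_integrable :: "'w measure \<Rightarrow> ('w \<Rightarrow> 'b::euclidean_space) \<Rightarrow> bool" where
  "sq_integrable M V \<longleftrightarrow> V \<in> borel_measurable M \<and> integrable M (\<lambda>\<omega>. (norm (V \<omega>))\<^sup>2)"

lemma sq_integrableI_bound:
  assumes "integrable M B" and "V \<in> borel_measurable M"
    and "\<And>\<omega>. \<omega> \<in> space M \<Longrightarrow> (norm (V \<omega>))\<^sup>2 \<le> B \<omega>"
  shows "sq_integrable M V"
  unfolding sq_integrable_def
  by (intro conjI Bochner_Integration.integrable_bound[OF assms(1)] AE_I2)
    (use assms in \<open>auto intro: order_trans[OF _ abs_ge_self]\<close>)

lemma norm_add_sq_le: "(norm (a + b))\<^sup>2 \<le> 2 * (norm a)\<^sup>2 + 2 * (norm (b::'b::real_inner))\<^sup>2"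
proof -
  have "(norm (a + b))\<^sup>2 + (norm (a - b))\<^sup>2 = 2 * (norm a)\<^sup>2 + 2 * (norm b)\<^sup>2"
    by (simp add: power2_norm_eq_inner inner_add inner_diff inner_commute)
  then show ?thesis by (smt (verit) zero_le_power2)
qed

lemma sq_integrable_add:
  assumes "sq_integrable M V" "sq_integrable M W"
  shows "sq_integrable M (\<lambda>\<omega>. V \<omega> + W \<omega>)"
  by (rule sq_integrableI_bound[where B = "\<lambda>\<omega>. 2 * (norm (V \<omega>))\<^sup>2 + 2 * (norm (W \<omega>))\<^sup>2"])
    (use assms norm_add_sq_le in \<open>auto simp: sq_integrable_def\<close>)

lemma sq_integrable_scaleR:
  "sq_integrable M V \<Longrightarrow> sq_integrable M (\<lambda>\<omega>. c *\<^sub>R V \<omega>)"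
  by (auto simp: sq_integrable_def power_mult_distrib)

lemma sq_integrable_diff:
  assumes "sq_integrable M V" "sq_integrable M W"
  shows "sq_integrable M (\<lambda>\<omega>. V \<omega> - W \<omega>)"
  using sq_integrable_add[OF assms(1) sq_integrable_scaleR[OF assms(2), of "-1"]] by simp

lemma sq_integrable_inner:
  assumes "sq_integrable M V" "sq_integrable M W"
  shows "integrable M (\<lambda>\<omega>. V \<omega> \<bullet> W \<omega>)"
proof (rule Bochner_Integration.integrable_bound)
  show "integrable M (\<lambda>\<omega>. (norm (V \<omega>))\<^sup>2 + (norm (W \<omega>))\<^sup>2)"
    using assms by (simp add: sq_integrable_def)
  have "\<bar>a \<bullet> b\<bar> \<le> (norm a)\<^sup>2 + (norm b)\<^sup>2" for a b :: 'b
  proof -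
    have "2 * (norm a * norm b) \<le> (norm a)\<^sup>2 + (norm b)\<^sup>2"
      using sum_squares_bound[of "norm a" "norm b"] by simp
    moreover have "0 \<le> norm a * norm b" by simp
    ultimately show ?thesis using Cauchy_Schwarz_ineq2[of a b] by linarith
  qed
  then show "AE \<omega> in M. norm (V \<omega> \<bullet> W \<omega>) \<le> norm ((norm (V \<omega>))\<^sup>2 + (norm (W \<omega>))\<^sup>2)"
    by simp
qed (use assms in \<open>auto simp: sq_integrable_def\<close>)

lemma (in finite_measure) sq_integrable_const: "sq_integrable M (\<lambda>_. c)"
  by (simp add: sq_integrable_def)

lemma (in finite_measure) sq_integrable_lipschitz:
  fixes h :: "'b::euclidean_space \<Rightarrow> 'c::euclidean_space"
  assumes V: "sq_integrable M V" and h: "\<And>u v. norm (h u - h v) \<le> C * norm (u - v)"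
  shows "sq_integrable M (\<lambda>\<omega>. h (V \<omega>))"
proof (rule sq_integrableI_bound[where B = "\<lambda>\<omega>. 2 * (norm (h 0))\<^sup>2 + 2 * (C\<^sup>2 * (norm (V \<omega>))\<^sup>2)"])
  have "continuous_on UNIV h" by (rule continuous_on_norm_lipschitz[OF h])
  then have "h \<in> borel_measurable borel" by (rule borel_measurable_continuous_onI)
  from measurable_compose[OF _ this, of V M] V show "(\<lambda>\<omega>. h (V \<omega>)) \<in> borel_measurable M"
    unfolding sq_integrable_def by blast
  fix \<omega>
  have "(norm (h (V \<omega>) - h 0))\<^sup>2 \<le> (C * norm (V \<omega>))\<^sup>2"
    using h[of "V \<omega>" 0] by (intro power_mono) auto
  then show "(norm (h (V \<omega>)))\<^sup>2 \<le> 2 * (norm (h 0))\<^sup>2 + 2 * (C\<^sup>2 * (norm (V \<omega>))\<^sup>2)"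
    using norm_add_sq_le[of "h 0" "h (V \<omega>) - h 0"] by (simp add: power_mult_distrib)
qed (use V in \<open>simp add: sq_integrable_def\<close>)

lemma sq_integrable_cong:
  "(\<And>\<omega>. \<omega> \<in> space M \<Longrightarrow> V \<omega> = W \<omega>) \<Longrightarrow> sq_integrable M V \<longleftrightarrow> sq_integrable M W"
  unfolding sq_integrable_def
  by (intro conj_cong measurable_cong Bochner_Integration.integrable_cong) auto

lemma norm_convex_combination_sq_le:
  fixes a b :: "'b::real_inner"
  assumes "0 \<le> t" "t \<le> 1"
  shows "(norm (t *\<^sub>R a + (1 - t) *\<^sub>R b))\<^sup>2 \<le> t * (norm a)\<^sup>2 + (1 - t) * (norm b)\<^sup>2"
proof -
  have "t * (norm a)\<^sup>2 + (1 - t) * (norm b)\<^sup>2 - (norm (t *\<^sub>R a + (1 - t) *\<^sub>R b))\<^sup>2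
      = t * (1 - t) * (norm (a - b))\<^sup>2"
    unfolding power2_norm_eq_inner
    by (simp add: inner_add inner_diff inner_commute algebra_simps)
  moreover have "0 \<le> t * (1 - t) * (norm (a - b))\<^sup>2" using assms by simp
  ultimately show ?thesis by linarith
qed

lemma (in finite_measure) integrable_quadratic_growth:
  fixes h :: "'b::euclidean_space \<Rightarrow> real"
  assumes V: "sq_integrable M V" and h: "continuous_on UNIV h"
    and growth: "\<And>v. \<bar>h v - h 0 - v \<bullet> d\<bar> \<le> Q * (norm v)\<^sup>2"
  shows "integrable M (\<lambda>\<omega>. h (V \<omega>))"
proof (rule Bochner_Integration.integrable_bound)
  have Vd: "integrable M (\<lambda>\<omega>. V \<omega> \<bullet> d)"
    by (rule sq_integrable_inner[OF V sq_integrable_const])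
  then show "integrable M (\<lambda>\<omega>. \<bar>h 0\<bar> + \<bar>V \<omega> \<bullet> d\<bar> + Q * (norm (V \<omega>))\<^sup>2)"
    using V by (simp add: sq_integrable_def)
  have "h \<in> borel_measurable borel" using h by (rule borel_measurable_continuous_onI)
  from measurable_compose[OF _ this, of V M] V show "(\<lambda>\<omega>. h (V \<omega>)) \<in> borel_measurable M"
    unfolding sq_integrable_def by blast
  show "AE \<omega> in M. norm (h (V \<omega>)) \<le> norm (\<bar>h 0\<bar> + \<bar>V \<omega> \<bullet> d\<bar> + Q * (norm (V \<omega>))\<^sup>2)"
  proof (rule AE_I2)
    fix \<omega>
    show "norm (h (V \<omega>)) \<le> norm (\<bar>h 0\<bar> + \<bar>V \<omega> \<bullet> d\<bar> + Q * (norm (V \<omega>))\<^sup>2)"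
      using growth[of "V \<omega>"] unfolding real_norm_def by linarith
  qed
qed

section \<open>Independence and a uniformly random index\<close>

lemma (in prob_space) indep_var_of_indep_set:
  assumes ind: "indep_set (sets A) (sets B)"
    and A: "space A = space M" "X \<in> A \<rightarrow>\<^sub>M N" and B: "space B = space M" "Y \<in> B \<rightarrow>\<^sub>M N'"
  shows "indep_var N X N' Y"
proof -
  have ev: "sets A \<subseteq> events" "sets B \<subseteq> events"
    and mult: "\<And>a b. a \<in> sets A \<Longrightarrow> b \<in> sets B \<Longrightarrow> prob (a \<inter> b) = prob a * prob b"
    using ind by (auto simp: indep_sets2_eq)
  have sub: "sigma_sets (space M) {X -` a \<inter> space M |a. a \<in> sets N} \<subseteq> sets A"
    "sigma_sets (space M) {Y -` a \<inter> space M |a. a \<in> sets N'} \<subseteq> sets B"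
    using sets.sigma_sets_subset[of "{X -` a \<inter> space A |a. a \<in> sets N}" A]
      sets.sigma_sets_subset[of "{Y -` a \<inter> space B |a. a \<in> sets N'}" B]
      measurable_sets[OF A(2)] measurable_sets[OF B(2)] A(1) B(1) by auto
  have "X \<in> M \<rightarrow>\<^sub>M N" "Y \<in> M \<rightarrow>\<^sub>M N'"
    using A(1) B(1) ev measurable_space[OF A(2)] measurable_sets[OF A(2)]
      measurable_space[OF B(2)] measurable_sets[OF B(2)]
    by (auto intro!: measurableI)
  moreover have "indep_set (sigma_sets (space M) {X -` a \<inter> space M |a. a \<in> sets N})
      (sigma_sets (space M) {Y -` a \<inter> space M |a. a \<in> sets N'})"
    unfolding indep_sets2_eq using sub ev mult by blast
  ultimately show ?thesis unfolding indep_var_eq by blast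
qed

text \<open>The two value spaces are unrelated: the iterates live in \<open>\<real>\<^sup>n\<close>, the samples in an arbitrary
  measurable space.\<close>

lemma (in prob_space) distr_Pair_of_indep_set:
  assumes ind: "indep_set (sets A) (sets B)"
    and A: "space A = space M" "X \<in> A \<rightarrow>\<^sub>M N" and B: "space B = space M" "Y \<in> B \<rightarrow>\<^sub>M N'"
  shows "distr M (N \<Otimes>\<^sub>M N') (\<lambda>\<omega>. (X \<omega>, Y \<omega>)) = distr M N X \<Otimes>\<^sub>M distr M N' Y"
proof -
  have ev: "sets A \<subseteq> events" "sets B \<subseteq> events"
    and mult: "\<And>a b. a \<in> sets A \<Longrightarrow> b \<in> sets B \<Longrightarrow> prob (a \<inter> b) = prob a * prob b"
    using ind by (auto simp: indep_sets2_eq)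
  have XY [measurable]: "X \<in> M \<rightarrow>\<^sub>M N" "Y \<in> M \<rightarrow>\<^sub>M N'"
    using A(1) B(1) ev measurable_space[OF A(2)] measurable_sets[OF A(2)]
      measurable_space[OF B(2)] measurable_sets[OF B(2)]
    by (auto intro!: measurableI)
  interpret X: prob_space "distr M N X" by (rule prob_space_distr) fact
  interpret Y: prob_space "distr M N' Y" by (rule prob_space_distr) fact
  show ?thesis
  proof (rule pair_measure_eqI[symmetric])
    fix a b assume ab: "a \<in> sets (distr M N X)" "b \<in> sets (distr M N' Y)"
    then have "X -` a \<inter> space M \<in> sets A" "Y -` b \<inter> space M \<in> sets B"
      using measurable_sets[OF A(2)] measurable_sets[OF B(2)] A(1) B(1) by auto
    from mult[OF this] have "prob ((X -` a \<inter> space M) \<inter> (Y -` b \<inter> space M))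
        = prob (X -` a \<inter> space M) * prob (Y -` b \<inter> space M)" .
    moreover have "(\<lambda>\<omega>. (X \<omega>, Y \<omega>)) -` (a \<times> b) \<inter> space M
        = (X -` a \<inter> space M) \<inter> (Y -` b \<inter> space M)" by auto
    ultimately show "emeasure (distr M N X) a * emeasure (distr M N' Y) b
        = emeasure (distr M (N \<Otimes>\<^sub>M N') (\<lambda>\<omega>. (X \<omega>, Y \<omega>))) (a \<times> b)"
      using ab by (simp add: emeasure_distr emeasure_eq_measure ennreal_mult)
  qed (auto intro: X.sigma_finite_measure_axioms Y.sigma_finite_measure_axioms)
qed

text \<open>Split the integrand according to the value of the index and use independence for each value.
  The index lies in \<open>J\<close> only almost surely, which is why measurability of \<open>V j\<close> is asked for all \<open>j\<close>.\<close>

lemma (in prob_space) expectation_at_random_index: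
  fixes V :: "int \<Rightarrow> 'a \<Rightarrow> real"
  assumes J: "finite J" "J \<noteq> {}"
    and \<kappa>: "\<kappa> \<in> M \<rightarrow>\<^sub>M count_space UNIV"
    and distr: "distr M (count_space UNIV) \<kappa> = measure_pmf (pmf_of_set J)"
    and indep: "indep_set (sets (vimage_algebra (space M) \<kappa> (count_space UNIV))) (sets B)"
    and B: "space B = space M" "\<And>j. V j \<in> borel_measurable B"
    and int: "\<And>j. integrable M (V j)"
  shows "integrable M (\<lambda>\<omega>. V (\<kappa> \<omega>) \<omega>)"
    and "(\<integral>\<omega>. V (\<kappa> \<omega>) \<omega> \<partial>M) = (\<Sum>j\<in>J. \<integral>\<omega>. V j \<omega> \<partial>M) / real (card J)"
proof -
  note [measurable] = \<kappa>
  have [measurable]: "V j \<in> borel_measurable M" for j using int by auto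
  have meas: "(\<lambda>\<omega>. V (\<kappa> \<omega>) \<omega>) \<in> borel_measurable M"
    by (rule measurable_compose_countable[OF _ \<kappa>]) simp
  have prob_eq: "(\<integral>\<omega>. indicat_real {j} (\<kappa> \<omega>) \<partial>M) = 1 / real (card J)" if "j \<in> J" for j
  proof -
    have "(\<integral>\<omega>. indicat_real {j} (\<kappa> \<omega>) \<partial>M) = (\<integral>i. indicat_real {j} i \<partial>distr M (count_space UNIV) \<kappa>)"
      by (subst integral_distr) auto
    also have "\<dots> = 1 / real (card J)"
      unfolding distr using that J by (simp add: measure_pmf_single)
    finally show ?thesis .
  qed
  have prod: "integrable M (\<lambda>\<omega>. indicat_real {j} (\<kappa> \<omega>) * V j \<omega>)"
      "(\<integral>\<omega>. indicat_real {j} (\<kappa> \<omega>) * V j \<omega> \<partial>M)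
        = (\<integral>\<omega>. indicat_real {j} (\<kappa> \<omega>) \<partial>M) * (\<integral>\<omega>. V j \<omega> \<partial>M)" for j
  proof -
    have \<kappa>': "\<kappa> \<in> vimage_algebra (space M) \<kappa> (count_space UNIV) \<rightarrow>\<^sub>M count_space UNIV"
      by (rule measurable_vimage_algebra1) simp
    then have "(\<lambda>\<omega>. indicat_real {j} (\<kappa> \<omega>))
        \<in> borel_measurable (vimage_algebra (space M) \<kappa> (count_space UNIV))"
      by (rule measurable_compose) simp
    from indep_var_of_indep_set[OF indep _ this B(1) B(2)]
    have "indep_var borel (\<lambda>\<omega>. indicat_real {j} (\<kappa> \<omega>)) borel (V j)" by simp
    moreover have "integrable M (\<lambda>\<omega>. indicat_real {j} (\<kappa> \<omega>))"
      by (rule integrable_const_bound[where B = 1]) (auto simp: indicator_def)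
    ultimately show "integrable M (\<lambda>\<omega>. indicat_real {j} (\<kappa> \<omega>) * V j \<omega>)"
      "(\<integral>\<omega>. indicat_real {j} (\<kappa> \<omega>) * V j \<omega> \<partial>M)
        = (\<integral>\<omega>. indicat_real {j} (\<kappa> \<omega>) \<partial>M) * (\<integral>\<omega>. V j \<omega> \<partial>M)"
      using int by (auto intro: indep_var_integrable indep_var_lebesgue_integral)
  qed
  have "AE i in distr M (count_space UNIV) \<kappa>. i \<in> J"
    unfolding distr using J by (simp add: AE_measure_pmf_iff)
  then have in_J: "AE \<omega> in M. \<kappa> \<omega> \<in> J" by (subst (asm) AE_distr_iff) auto
  have decomp: "V i \<omega> = (\<Sum>j\<in>J. indicat_real {j} i * V j \<omega>)" if "i \<in> J" for i \<omega>
  proof -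
    have "(\<Sum>j\<in>J. indicat_real {j} i * V j \<omega>) = (\<Sum>j\<in>J. if j = i then V j \<omega> else 0)"
      by (intro sum.cong) (auto simp: indicator_def)
    then show ?thesis using that J by simp
  qed
  from in_J have eq: "AE \<omega> in M. V (\<kappa> \<omega>) \<omega> = (\<Sum>j\<in>J. indicat_real {j} (\<kappa> \<omega>) * V j \<omega>)"
    by eventually_elim (rule decomp)
  have sum: "integrable M (\<lambda>\<omega>. \<Sum>j\<in>J. indicat_real {j} (\<kappa> \<omega>) * V j \<omega>)"
    using prod by auto
  show "integrable M (\<lambda>\<omega>. V (\<kappa> \<omega>) \<omega>)"
    using integrable_cong_AE[OF meas _ eq] sum by auto
  have "(\<integral>\<omega>. V (\<kappa> \<omega>) \<omega> \<partial>M) = (\<integral>\<omega>. (\<Sum>j\<in>J. indicat_real {j} (\<kappa> \<omega>) * V j \<omega>) \<partial>M)"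
    using meas eq sum by (intro integral_cong_AE) auto
  also have "\<dots> = (\<Sum>j\<in>J. 1 / real (card J) * (\<integral>\<omega>. V j \<omega> \<partial>M))"
    using prod by (simp add: prob_eq)
  finally show "(\<integral>\<omega>. V (\<kappa> \<omega>) \<omega> \<partial>M) = (\<Sum>j\<in>J. \<integral>\<omega>. V j \<omega> \<partial>M) / real (card J)"
    by (simp add: sum_divide_distrib)
qed

section \<open>The heavy ball iteration and its noise\<close>

text \<open>The method with \<open>\<alpha> = \<alpha>\<^sub>0 \<beta>\<close>, the momentum update being written in terms of the previous
  momentum vector in place of \<open>(x\<^sub>k - x\<^sub>k\<^sub>+\<^sub>1)/\<alpha>\<close>.\<close>

locale heavy_ball = smooth_objective f \<rho> + P: prob_space P + M: prob_space M
  for f :: "real ^ 'n \<Rightarrow> real" and \<rho> and P :: "'s measure" and M :: "'w measure" +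
  fixes f' :: "real ^ 'n \<Rightarrow> 's \<Rightarrow> real ^ 'n" and S :: "nat \<Rightarrow> 'w \<Rightarrow> 's"
    and x z :: "nat \<Rightarrow> 'w \<Rightarrow> real ^ 'n" and x\<^sub>0 :: "real ^ 'n" and \<sigma> \<alpha>\<^sub>0 \<beta> :: real
  assumes f'_measurable: "(\<lambda>(u, s). f' u s) \<in> borel_measurable (borel \<Otimes>\<^sub>M P)"
    and f'_integrable: "integrable P (f' u)"
    and f'_mean: "(\<integral>s. f' u s \<partial>P) = gradient f u"
    and variance_integrable: "integrable P (\<lambda>s. (norm (f' u s - gradient f u))\<^sup>2)"
    and variance: "(\<integral>s. (norm (f' u s - gradient f u))\<^sup>2 \<partial>P) \<le> \<sigma>\<^sup>2"
    and S_indep: "M.indep_vars (\<lambda>_. P) S UNIV"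
    and S_distr: "distr M P (S k) = P"
    and x_0: "\<omega> \<in> space M \<Longrightarrow> x 0 \<omega> = x\<^sub>0"
    and x_Suc: "\<omega> \<in> space M \<Longrightarrow> x (Suc k) \<omega> = x k \<omega> - (\<alpha>\<^sub>0 * \<beta>) *\<^sub>R z k \<omega>"
    and z_0: "\<omega> \<in> space M \<Longrightarrow> z 0 \<omega> = f' (x 0 \<omega>) (S 0 \<omega>)"
    and z_Suc: "\<omega> \<in> space M \<Longrightarrow>
      z (Suc k) \<omega> = \<beta> *\<^sub>R f' (x (Suc k) \<omega>) (S (Suc k) \<omega>) + (1 - \<beta>) *\<^sub>R z k \<omega>"
    and alpha0: "\<alpha>\<^sub>0 > 0" and beta: "0 < \<beta>" "\<beta> \<le> 1"
begin

definition g :: "nat \<Rightarrow> 'w \<Rightarrow> real ^ 'n" where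
  "g k \<omega> = f' (x k \<omega>) (S k \<omega>)"

definition noise :: "nat \<Rightarrow> 'w \<Rightarrow> real ^ 'n" where
  "noise k \<omega> = g k \<omega> - gradient f (x k \<omega>)"

text \<open>The value \<open>0\<close> at time \<open>0\<close> encodes the convention \<open>x\<^sub>-\<^sub>1 = x\<^sub>0\<close>.\<close>

definition z_prev :: "nat \<Rightarrow> 'w \<Rightarrow> real ^ 'n" where
  "z_prev k \<omega> = (case k of 0 \<Rightarrow> 0 | Suc j \<Rightarrow> z j \<omega>)"

text \<open>Because \<open>z\<^sub>0 = g\<^sub>0\<close>, the first gradient enters the momentum with weight \<open>1\<close>, all others with
  weight \<open>\<beta>\<close>. With this convention one formula covers every step.\<close>

definition weight :: "nat \<Rightarrow> real" where
  "weight k = (if k = 0 then 1 else \<beta>)"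

text \<open>The extrapolated point: for \<open>k \<ge> 1\<close> the difference \<open>x\<^sub>k - x\<^sub>k\<^sub>-\<^sub>1\<close> is \<open>-\<alpha>\<^sub>0 \<beta> z\<^sub>k\<^sub>-\<^sub>1\<close>.\<close>

definition xbar :: "nat \<Rightarrow> 'w \<Rightarrow> real ^ 'n" where
  "xbar k \<omega> = x k \<omega> - (\<alpha>\<^sub>0 * (1 - \<beta>)) *\<^sub>R z_prev k \<omega>"

lemma z_eq: "\<omega> \<in> space M \<Longrightarrow> z k \<omega> = weight k *\<^sub>R g k \<omega> + (1 - weight k) *\<^sub>R z_prev k \<omega>"
  by (cases k) (simp_all add: z_0 z_Suc g_def weight_def z_prev_def)

text \<open>The extrapolation removes the memory: the terms in \<open>z\<^sub>k\<^sub>-\<^sub>1\<close> cancel and what is left is a stochastic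
  gradient step, of length \<open>\<alpha>\<^sub>0\<close> for \<open>k = 0\<close> and \<open>\<alpha>\<close> afterwards.\<close>

lemma xbar_Suc:
  assumes "\<omega> \<in> space M"
  shows "xbar (Suc k) \<omega> = xbar k \<omega> - (\<alpha>\<^sub>0 * weight k) *\<^sub>R g k \<omega>"
proof -
  have "xbar (Suc k) \<omega> = x k \<omega> - \<alpha>\<^sub>0 *\<^sub>R z k \<omega>"
    using assms by (simp add: xbar_def z_prev_def x_Suc algebra_simps)
  then show ?thesis
    unfolding z_eq[OF assms, of k] by (cases k) (simp_all add: xbar_def z_prev_def weight_def algebra_simps)
qed

text \<open>Stated for an arbitrary \<open>\<sigma>\<close>-algebra that makes the first samples measurable: it is applied to
  the history up to time \<open>k\<close>, for independence of the next sample, and to the \<open>\<sigma>\<close>-algebra of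
  the whole sample sequence, for independence of the random index.\<close>

lemma iterates_measurable:
  assumes A: "space A = space M" and "\<And>i. i < k \<Longrightarrow> S i \<in> A \<rightarrow>\<^sub>M P"
  shows "x k \<in> borel_measurable A" "z_prev k \<in> borel_measurable A"
proof -
  have "x k \<in> borel_measurable A \<and> z_prev k \<in> borel_measurable A" using assms(2)
  proof (induction k)
    case 0
    have "(\<lambda>_. x\<^sub>0) \<in> borel_measurable A" by simp
    then have "x 0 \<in> borel_measurable A"
      by (subst measurable_cong[where g = "\<lambda>_. x\<^sub>0"]) (auto simp: A x_0)
    moreover have "z_prev 0 = (\<lambda>_. 0)" by (auto simp: z_prev_def)
    ultimately show ?case by simp
  next
    case (Suc k)
    then have [measurable]: "x k \<in> borel_measurable A" "z_prev k \<in> borel_measurable A" "S k \<in> A \<rightarrow>\<^sub>M P"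
      by auto
    have "(\<lambda>\<omega>. (x k \<omega>, S k \<omega>)) \<in> A \<rightarrow>\<^sub>M borel \<Otimes>\<^sub>M P" by measurable
    from measurable_compose[OF this f'_measurable]
    have [measurable]: "g k \<in> borel_measurable A" by (simp add: g_def[abs_def])
    have "(\<lambda>\<omega>. weight k *\<^sub>R g k \<omega> + (1 - weight k) *\<^sub>R z_prev k \<omega>) \<in> borel_measurable A"
      by measurable
    then have [measurable]: "z k \<in> borel_measurable A"
      by (subst measurable_cong[OF z_eq]) (auto simp: A)
    have "(\<lambda>\<omega>. x k \<omega> - (\<alpha>\<^sub>0 * \<beta>) *\<^sub>R z k \<omega>) \<in> borel_measurable A" by measurable
    then have "x (Suc k) \<in> borel_measurable A"
      by (subst measurable_cong[OF x_Suc]) (auto simp: A)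
    moreover have "z_prev (Suc k) = z k" by (auto simp: z_prev_def)
    ultimately show ?case by simp
  qed
  then show "x k \<in> borel_measurable A" "z_prev k \<in> borel_measurable A" by auto
qed

lemma S_measurable [measurable]: "S k \<in> M \<rightarrow>\<^sub>M P"
  using S_indep unfolding M.indep_vars_def by blast

definition past :: "nat \<Rightarrow> 'w measure" where
  "past k = vimage_algebra (space M) (\<lambda>\<omega>. \<lambda>i\<in>{..<k}. S i \<omega>) (Pi\<^sub>M {..<k} (\<lambda>_. P))"

lemma space_past [simp]: "space (past k) = space M"
  by (simp add: past_def)

lemma past_subset: "sets (past k) \<subseteq> sets M"
  unfolding past_def by (intro sets_image_in_sets measurable_restrict) auto

lemma measurable_past: "V \<in> past k \<rightarrow>\<^sub>M N \<Longrightarrow> V \<in> M \<rightarrow>\<^sub>M N"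
  using past_subset[of k] by (auto simp: measurable_def)

lemma S_measurable_vimage:
  assumes "i \<in> I"
  shows "S i \<in> vimage_algebra (space M) (\<lambda>\<omega>. \<lambda>i\<in>I. S i \<omega>) (Pi\<^sub>M I (\<lambda>_. P)) \<rightarrow>\<^sub>M P"
    (is "_ \<in> ?A \<rightarrow>\<^sub>M P")
proof -
  have "(\<lambda>\<omega>. \<lambda>i\<in>I. S i \<omega>) \<in> ?A \<rightarrow>\<^sub>M Pi\<^sub>M I (\<lambda>_. P)"
    by (rule measurable_vimage_algebra1) (auto simp: space_PiM measurable_space[OF S_measurable])
  from measurable_compose[OF this measurable_component_singleton[OF assms]] show ?thesis
    using assms by simp
qed

lemma S_measurable_past: "i < k \<Longrightarrow> S i \<in> past k \<rightarrow>\<^sub>M P"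
  unfolding past_def by (rule S_measurable_vimage) simp

lemma x_past [measurable]: "x k \<in> borel_measurable (past k)"
  and z_prev_past [measurable]: "z_prev k \<in> borel_measurable (past k)"
  using iterates_measurable[of "past k" k] S_measurable_past by auto

lemma indep_past:
  "M.indep_set (sets (past k))
    (sets (vimage_algebra (space M) (\<lambda>\<omega>. \<lambda>i\<in>{k}. S i \<omega>) (Pi\<^sub>M {k} (\<lambda>_. P))))"
proof -
  have "M.indep_var (Pi\<^sub>M {..<k} (\<lambda>_. P)) (\<lambda>\<omega>. \<lambda>i\<in>{..<k}. S i \<omega>) (Pi\<^sub>M {k} (\<lambda>_. P)) (\<lambda>\<omega>. \<lambda>i\<in>{k}. S i \<omega>)"
    by (rule M.indep_var_restrict[OF S_indep]) auto
  then show ?thesis unfolding M.indep_var_eq past_def sets_vimage_algebra by blast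
qed

lemma distr_past:
  assumes "V \<in> past k \<rightarrow>\<^sub>M N"
  shows "distr M (N \<Otimes>\<^sub>M P) (\<lambda>\<omega>. (V \<omega>, S k \<omega>)) = distr M N V \<Otimes>\<^sub>M P"
proof -
  have "S k \<in> vimage_algebra (space M) (\<lambda>\<omega>. \<lambda>i\<in>{k}. S i \<omega>) (Pi\<^sub>M {k} (\<lambda>_. P)) \<rightarrow>\<^sub>M P"
    by (rule S_measurable_vimage) simp
  from M.distr_Pair_of_indep_set[OF indep_past _ assms _ this] show ?thesis
    by (simp add: S_distr)
qed

lemma f'_measurable' [measurable]:
  "(\<lambda>y. f' (fst y) (snd y)) \<in> borel_measurable (borel \<Otimes>\<^sub>M P)"
  using f'_measurable by (simp add: case_prod_beta')

lemma gradient_measurable [measurable]: "gradient f \<in> borel_measurable borel"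
  by (intro borel_measurable_continuous_onI continuous_gradient)

lemma noise_measurable [measurable]: "noise k \<in> borel_measurable M"
proof -
  have [measurable]: "x k \<in> borel_measurable M" by (rule measurable_past[OF x_past])
  have "(\<lambda>\<omega>. (x k \<omega>, S k \<omega>)) \<in> M \<rightarrow>\<^sub>M borel \<Otimes>\<^sub>M P" by measurable
  from measurable_compose[OF this f'_measurable'] show ?thesis
    by (simp add: noise_def[abs_def] g_def)
qed

text \<open>The pair of iterate and fresh sample has a product distribution, so the variance bound at fixed
  points can be integrated over the iterate.\<close>

lemma noise_sq_integrable: "sq_integrable M (noise k)"
  and noise_variance: "(\<integral>\<omega>. (norm (noise k \<omega>))\<^sup>2 \<partial>M) \<le> \<sigma>\<^sup>2"
proof -
  let ?X = "distr M borel (x k)"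
  have [measurable]: "x k \<in> borel_measurable M" by (rule measurable_past[OF x_past])
  interpret X: prob_space ?X by (rule M.prob_space_distr) simp
  have "(\<integral>\<^sup>+\<omega>. ennreal ((norm (noise k \<omega>))\<^sup>2) \<partial>M)
      = (\<integral>\<^sup>+y. ennreal ((norm (f' (fst y) (snd y) - gradient f (fst y)))\<^sup>2)
          \<partial>distr M (borel \<Otimes>\<^sub>M P) (\<lambda>\<omega>. (x k \<omega>, S k \<omega>)))"
    by (subst nn_integral_distr) (simp_all add: noise_def g_def)
  also have "\<dots> = (\<integral>\<^sup>+u. \<integral>\<^sup>+s. ennreal ((norm (f' u s - gradient f u))\<^sup>2) \<partial>P \<partial>?X)"
    unfolding distr_past[OF x_past] by (subst P.nn_integral_fst[symmetric]) simp_all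
  also have "\<dots> \<le> (\<integral>\<^sup>+u. ennreal (\<sigma>\<^sup>2) \<partial>?X)"
  proof (rule nn_integral_mono)
    fix u
    show "(\<integral>\<^sup>+s. ennreal ((norm (f' u s - gradient f u))\<^sup>2) \<partial>P) \<le> ennreal (\<sigma>\<^sup>2)"
      by (subst nn_integral_eq_integral[OF variance_integrable]) (auto intro: ennreal_leI variance)
  qed
  also have "\<dots> = ennreal (\<sigma>\<^sup>2)" by (simp add: X.emeasure_space_1[simplified])
  finally have le: "(\<integral>\<^sup>+\<omega>. ennreal ((norm (noise k \<omega>))\<^sup>2) \<partial>M) \<le> ennreal (\<sigma>\<^sup>2)" .
  then have "integrable M (\<lambda>\<omega>. (norm (noise k \<omega>))\<^sup>2)"
    by (intro integrableI_bounded) (auto simp: le_less_trans)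
  then show "sq_integrable M (noise k)" by (simp add: sq_integrable_def)
  show "(\<integral>\<omega>. (norm (noise k \<omega>))\<^sup>2 \<partial>M) \<le> \<sigma>\<^sup>2"
    using le by (subst integral_eq_nn_integral) (auto simp: enn2real_leI)
qed

text \<open>A vector known before the sample \<open>S\<^sub>k\<close> is drawn is a constant for the inner integral over \<open>P\<close>, and
  there the noise has mean zero.\<close>

lemma noise_orthogonal:
  assumes V: "V \<in> borel_measurable (past k)" and sq: "sq_integrable M V"
  shows "(\<integral>\<omega>. V \<omega> \<bullet> noise k \<omega> \<partial>M) = 0"
proof -
  have [measurable]: "V \<in> borel_measurable (past k)" by (rule V)
  have Y: "(\<lambda>\<omega>. (V \<omega>, x k \<omega>)) \<in> past k \<rightarrow>\<^sub>M borel \<Otimes>\<^sub>M borel" by measurable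
  let ?Y = "distr M (borel \<Otimes>\<^sub>M borel) (\<lambda>\<omega>. (V \<omega>, x k \<omega>))"
  let ?h = "\<lambda>y. fst (fst y) \<bullet> (f' (snd (fst y)) (snd y) - gradient f (snd (fst y)))"
  have [measurable]: "x k \<in> borel_measurable M" "V \<in> borel_measurable M"
    by (rule measurable_past, measurable)+
  interpret Y: prob_space ?Y by (rule M.prob_space_distr) measurable
  interpret YP: pair_sigma_finite ?Y P ..
  have "(\<lambda>y. (snd (fst y), snd y)) \<in> ((borel \<Otimes>\<^sub>M borel) \<Otimes>\<^sub>M P) \<rightarrow>\<^sub>M (borel \<Otimes>\<^sub>M P)" by measurable
  from measurable_compose[OF this f'_measurable']
  have [measurable]: "(\<lambda>y. f' (snd (fst y)) (snd y)) \<in> borel_measurable ((borel \<Otimes>\<^sub>M borel) \<Otimes>\<^sub>M P)"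
    by simp
  have h: "?h \<in> borel_measurable ((borel \<Otimes>\<^sub>M borel) \<Otimes>\<^sub>M P)" by measurable
  have map: "(\<lambda>\<omega>. ((V \<omega>, x k \<omega>), S k \<omega>)) \<in> M \<rightarrow>\<^sub>M ((borel \<Otimes>\<^sub>M borel) \<Otimes>\<^sub>M P)" by measurable
  have eq: "V \<omega> \<bullet> noise k \<omega> = ?h ((V \<omega>, x k \<omega>), S k \<omega>)" for \<omega>
    by (simp add: noise_def g_def)
  have "integrable M (\<lambda>\<omega>. ?h ((V \<omega>, x k \<omega>), S k \<omega>))"
    using sq_integrable_inner[OF sq noise_sq_integrable[of k]] unfolding eq .
  then have int: "integrable (?Y \<Otimes>\<^sub>M P) ?h"
    using integrable_distr_eq[OF map h] unfolding distr_past[OF Y] by simp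
  have "(\<integral>\<omega>. V \<omega> \<bullet> noise k \<omega> \<partial>M) = (\<integral>y. ?h y \<partial>(?Y \<Otimes>\<^sub>M P))"
    using integral_distr[OF map h] unfolding distr_past[OF Y] eq by simp
  also have "\<dots> = (\<integral>y. \<integral>s. ?h (y, s) \<partial>P \<partial>?Y)"
    using YP.integral_fst'[OF int] by simp
  also have "\<dots> = (\<integral>y. 0 \<partial>?Y)"
  proof (rule Bochner_Integration.integral_cong[OF refl])
    fix y :: "(real ^ 'n) \<times> (real ^ 'n)"
    have "(\<integral>s. fst y \<bullet> (f' (snd y) s - gradient f (snd y)) \<partial>P)
        = fst y \<bullet> (\<integral>s. f' (snd y) s - gradient f (snd y) \<partial>P)"
      using f'_integrable by (intro integral_inner_right) auto
    also have "(\<integral>s. f' (snd y) s - gradient f (snd y) \<partial>P) = 0"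
      using f'_integrable by (simp add: f'_mean P.prob_space)
    finally show "(\<integral>s. ?h (y, s) \<partial>P) = 0" by simp
  qed
  finally show ?thesis by simp
qed

end

section \<open>Energy estimates in expectation\<close>

context heavy_ball
begin

lemma g_eq: "g k \<omega> = gradient f (x k \<omega>) + noise k \<omega>"
  by (simp add: noise_def)

lemma weight_bounds: "0 < weight k" "weight k \<le> 1"
  using beta by (auto simp: weight_def)

lemma iterates_sq_integrable:
  "sq_integrable M (x k) \<and> sq_integrable M (z_prev k)"
proof (induction k)
  case 0
  have "sq_integrable M (x 0) = sq_integrable M (\<lambda>_. x\<^sub>0)" by (rule sq_integrable_cong) (simp add: x_0)
  moreover have "z_prev 0 = (\<lambda>_. 0)" by (auto simp: z_prev_def)
  ultimately show ?case by (simp add: M.sq_integrable_const)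
next
  case (Suc k)
  have g: "sq_integrable M (g k)"
    unfolding g_eq[abs_def]
    by (intro sq_integrable_add noise_sq_integrable M.sq_integrable_lipschitz[OF _ gradient_lipschitz] Suc[THEN conjunct1])
  have "sq_integrable M (z k) = sq_integrable M (\<lambda>\<omega>. weight k *\<^sub>R g k \<omega> + (1 - weight k) *\<^sub>R z_prev k \<omega>)"
    by (rule sq_integrable_cong) (rule z_eq)
  then have z: "sq_integrable M (z k)"
    using g Suc by (simp add: sq_integrable_add sq_integrable_scaleR)
  have "sq_integrable M (x (Suc k)) = sq_integrable M (\<lambda>\<omega>. x k \<omega> - (\<alpha>\<^sub>0 * \<beta>) *\<^sub>R z k \<omega>)"
    by (rule sq_integrable_cong) (rule x_Suc)
  moreover have "z_prev (Suc k) = z k" by (auto simp: z_prev_def)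
  ultimately show ?case
    using z Suc by (simp add: sq_integrable_diff sq_integrable_scaleR)
qed

lemma x_sq_integrable: "sq_integrable M (x k)" and z_prev_sq_integrable: "sq_integrable M (z_prev k)"
  using iterates_sq_integrable by auto

lemma xbar_sq_integrable: "sq_integrable M (xbar k)"
  unfolding xbar_def[abs_def] by (intro sq_integrable_diff sq_integrable_scaleR x_sq_integrable z_prev_sq_integrable)

lemma xbar_past [measurable]: "xbar k \<in> borel_measurable (past k)"
  unfolding xbar_def[abs_def] by measurable

lemma gradient_x_sq_integrable: "sq_integrable M (\<lambda>\<omega>. gradient f (x k \<omega>))"
  by (rule M.sq_integrable_lipschitz[OF x_sq_integrable gradient_lipschitz])

lemma gradient_x_past: "(\<lambda>\<omega>. gradient f (x k \<omega>)) \<in> borel_measurable (past k)"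
  by measurable

definition grad_sq :: "nat \<Rightarrow> real" where
  "grad_sq k = (\<integral>\<omega>. (norm (gradient f (x k \<omega>)))\<^sup>2 \<partial>M)"

definition mom_sq :: "nat \<Rightarrow> real" where
  "mom_sq k = (\<integral>\<omega>. (norm (z k \<omega>))\<^sup>2 \<partial>M)"

definition prev_mom_sq :: "nat \<Rightarrow> real" where
  "prev_mom_sq k = (\<integral>\<omega>. (norm (z_prev k \<omega>))\<^sup>2 \<partial>M)"

lemma expected_sq_add_noise:
  assumes "V \<in> borel_measurable (past k)" "sq_integrable M V"
  shows "(\<integral>\<omega>. (norm (V \<omega> + c *\<^sub>R noise k \<omega>))\<^sup>2 \<partial>M) \<le> (\<integral>\<omega>. (norm (V \<omega>))\<^sup>2 \<partial>M) + c\<^sup>2 * \<sigma>\<^sup>2"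
proof -
  have int: "integrable M (\<lambda>\<omega>. (norm (V \<omega>))\<^sup>2)" "integrable M (\<lambda>\<omega>. V \<omega> \<bullet> noise k \<omega>)"
    "integrable M (\<lambda>\<omega>. (norm (noise k \<omega>))\<^sup>2)"
    using assms noise_sq_integrable[of k] sq_integrable_inner[OF assms(2) noise_sq_integrable[of k]]
    by (auto simp: sq_integrable_def)
  have "(norm (v + c *\<^sub>R n))\<^sup>2 = (norm v)\<^sup>2 + 2 * c * (v \<bullet> n) + c\<^sup>2 * (norm n)\<^sup>2" for v n :: "real ^ 'n"
    unfolding power2_norm_eq_inner
    by (simp add: inner_add inner_commute algebra_simps power2_eq_square)
  then have "(\<integral>\<omega>. (norm (V \<omega> + c *\<^sub>R noise k \<omega>))\<^sup>2 \<partial>M)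
      = (\<integral>\<omega>. (norm (V \<omega>))\<^sup>2 + 2 * c * (V \<omega> \<bullet> noise k \<omega>) + c\<^sup>2 * (norm (noise k \<omega>))\<^sup>2 \<partial>M)"
    by simp
  also have "\<dots> = (\<integral>\<omega>. (norm (V \<omega>))\<^sup>2 \<partial>M) + c\<^sup>2 * (\<integral>\<omega>. (norm (noise k \<omega>))\<^sup>2 \<partial>M)"
    using int noise_orthogonal[OF assms] by simp
  also have "\<dots> \<le> (\<integral>\<omega>. (norm (V \<omega>))\<^sup>2 \<partial>M) + c\<^sup>2 * \<sigma>\<^sup>2"
    by (intro add_left_mono mult_left_mono noise_variance) simp
  finally show ?thesis .
qed

text \<open>One extrapolated step for any function with a quadratic upper model. It is applied to \<open>f\<close> itself
  and to its Moreau envelope.\<close>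

lemma expected_descent:
  fixes h :: "real ^ 'n \<Rightarrow> real" and k :: nat
  assumes h: "\<And>u v. h v \<le> h u + dh u \<bullet> (v - u) + C / 2 * (norm (v - u))\<^sup>2" and C: "0 \<le> C"
    and dh: "\<And>u v. norm (dh u - dh v) \<le> L * norm (u - v)"
    and int: "\<And>j. integrable M (\<lambda>\<omega>. h (xbar j \<omega>))"
  defines "s \<equiv> \<alpha>\<^sub>0 * weight k"
  shows "(\<integral>\<omega>. h (xbar (Suc k) \<omega>) \<partial>M) \<le> (\<integral>\<omega>. h (xbar k \<omega>) \<partial>M)
      - s * (\<integral>\<omega>. dh (xbar k \<omega>) \<bullet> gradient f (x k \<omega>) \<partial>M) + C / 2 * s\<^sup>2 * (grad_sq k + \<sigma>\<^sup>2)"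
proof -
  have dh_sq: "sq_integrable M (\<lambda>\<omega>. dh (xbar k \<omega>))"
    by (rule M.sq_integrable_lipschitz[OF xbar_sq_integrable dh])
  have "continuous_on UNIV dh" by (rule continuous_on_norm_lipschitz[OF dh])
  then have "dh \<in> borel_measurable borel" by (rule borel_measurable_continuous_onI)
  from measurable_compose[OF xbar_past this]
  have dh_past: "(\<lambda>\<omega>. dh (xbar k \<omega>)) \<in> borel_measurable (past k)" .
  have orth: "(\<integral>\<omega>. dh (xbar k \<omega>) \<bullet> noise k \<omega> \<partial>M) = 0"
    by (rule noise_orthogonal[OF dh_past dh_sq])
  note ints [simp] = int sq_integrable_inner[OF dh_sq noise_sq_integrable]
    sq_integrable_inner[OF dh_sq gradient_x_sq_integrable]
  have g_sq: "sq_integrable M (g k)"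
    unfolding g_eq[abs_def] by (intro sq_integrable_add noise_sq_integrable gradient_x_sq_integrable)
  have g2: "integrable M (\<lambda>\<omega>. (norm (g k \<omega>))\<^sup>2)" using g_sq by (simp add: sq_integrable_def)
  have "(\<integral>\<omega>. h (xbar (Suc k) \<omega>) \<partial>M) \<le> (\<integral>\<omega>. h (xbar k \<omega>)
      - s * (dh (xbar k \<omega>) \<bullet> gradient f (x k \<omega>)) - s * (dh (xbar k \<omega>) \<bullet> noise k \<omega>)
      + C / 2 * s\<^sup>2 * (norm (g k \<omega>))\<^sup>2 \<partial>M)"
  proof (rule integral_mono)
    fix \<omega> assume \<omega>: "\<omega> \<in> space M"
    have eq: "xbar (Suc k) \<omega> - xbar k \<omega> = - s *\<^sub>R g k \<omega>" using xbar_Suc[OF \<omega>] by (simp add: s_def)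
    show "h (xbar (Suc k) \<omega>) \<le> h (xbar k \<omega>)
      - s * (dh (xbar k \<omega>) \<bullet> gradient f (x k \<omega>)) - s * (dh (xbar k \<omega>) \<bullet> noise k \<omega>)
      + C / 2 * s\<^sup>2 * (norm (g k \<omega>))\<^sup>2"
      using h[of "xbar (Suc k) \<omega>" "xbar k \<omega>"] unfolding eq
      by (simp add: noise_def inner_diff_right power_mult_distrib algebra_simps)
  qed (use g2 in auto)
  also have "\<dots> = (\<integral>\<omega>. h (xbar k \<omega>) \<partial>M)
      - s * (\<integral>\<omega>. dh (xbar k \<omega>) \<bullet> gradient f (x k \<omega>) \<partial>M)
      + C / 2 * s\<^sup>2 * (\<integral>\<omega>. (norm (g k \<omega>))\<^sup>2 \<partial>M)"
    using g2 orth by simp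
  also have "C / 2 * s\<^sup>2 * (\<integral>\<omega>. (norm (g k \<omega>))\<^sup>2 \<partial>M) \<le> C / 2 * s\<^sup>2 * (grad_sq k + \<sigma>\<^sup>2)"
    using expected_sq_add_noise[OF gradient_x_past gradient_x_sq_integrable, where c = 1 and k = k] C
    by (intro mult_left_mono) (auto simp: g_eq grad_sq_def)
  finally show ?thesis by simp
qed

text \<open>Conditionally on the past, \<open>z\<^sub>k\<close> is a convex combination of \<open>\<nabla>f(x\<^sub>k)\<close> and \<open>z\<^sub>k\<^sub>-\<^sub>1\<close> plus centred noise.\<close>

lemma momentum_step: "mom_sq k \<le> weight k * grad_sq k + (1 - weight k) * prev_mom_sq k + (weight k)\<^sup>2 * \<sigma>\<^sup>2"
proof -
  define m where "m \<omega> = weight k *\<^sub>R gradient f (x k \<omega>) + (1 - weight k) *\<^sub>R z_prev k \<omega>" for \<omega>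
  have m_past: "m \<in> borel_measurable (past k)" unfolding m_def[abs_def] by measurable
  have m_sq: "sq_integrable M m"
    unfolding m_def[abs_def] by (intro sq_integrable_add sq_integrable_scaleR gradient_x_sq_integrable z_prev_sq_integrable)
  have "mom_sq k = (\<integral>\<omega>. (norm (m \<omega> + weight k *\<^sub>R noise k \<omega>))\<^sup>2 \<partial>M)"
    unfolding mom_sq_def
    by (rule Bochner_Integration.integral_cong[OF refl])
      (simp add: z_eq m_def g_eq scaleR_add_right add_ac)
  also have "\<dots> \<le> (\<integral>\<omega>. (norm (m \<omega>))\<^sup>2 \<partial>M) + (weight k)\<^sup>2 * \<sigma>\<^sup>2"
    by (rule expected_sq_add_noise[OF m_past m_sq])
  also have "(\<integral>\<omega>. (norm (m \<omega>))\<^sup>2 \<partial>M) \<le> (\<integral>\<omega>. weight k * (norm (gradient f (x k \<omega>)))\<^sup>2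
      + (1 - weight k) * (norm (z_prev k \<omega>))\<^sup>2 \<partial>M)"
    unfolding m_def
    using weight_bounds[of k] m_sq gradient_x_sq_integrable[of k] z_prev_sq_integrable[of k]
    by (intro integral_mono norm_convex_combination_sq_le) (auto simp: sq_integrable_def m_def[abs_def])
  also have "\<dots> = weight k * grad_sq k + (1 - weight k) * prev_mom_sq k"
    using gradient_x_sq_integrable[of k] z_prev_sq_integrable[of k] by (simp add: sq_integrable_def grad_sq_def prev_mom_sq_def)
  finally show ?thesis by simp
qed

lemma prev_mom_sq_Suc: "prev_mom_sq (Suc k) = mom_sq k"
  by (simp add: prev_mom_sq_def mom_sq_def z_prev_def)

text \<open>The single summand \<open>\<sigma>\<^sup>2\<close> is the noise of \<open>z\<^sub>0 = g\<^sub>0\<close>, which is not damped by \<open>\<beta>\<close>.\<close>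

lemma momentum_sum:
  "\<beta> * (\<Sum>k<N. mom_sq k) \<le> grad_sq 0 + \<sigma>\<^sup>2 + \<beta> * (\<Sum>k=1..N. grad_sq k) + N * (\<beta>\<^sup>2 * \<sigma>\<^sup>2) - mom_sq N"
proof (induction N)
  case 0
  show ?case using momentum_step[of 0] by (simp add: weight_def)
next
  case (Suc N)
  have "mom_sq (Suc N) \<le> \<beta> * grad_sq (Suc N) + (1 - \<beta>) * mom_sq N + \<beta>\<^sup>2 * \<sigma>\<^sup>2"
    using momentum_step[of "Suc N"] by (simp add: weight_def prev_mom_sq_Suc)
  with Suc show ?case by (simp add: algebra_simps)
qed

lemma x_diff_xbar: "norm (x k \<omega> - xbar k \<omega>) = \<alpha>\<^sub>0 * (1 - \<beta>) * norm (z_prev k \<omega>)"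
  using alpha0 beta by (simp add: xbar_def)

lemma gradient_gap: "norm (gradient f (xbar k \<omega>) - gradient f (x k \<omega>))
    \<le> \<rho> * (\<alpha>\<^sub>0 * (1 - \<beta>)) * norm (z_prev k \<omega>)"
  using gradient_lipschitz[of "xbar k \<omega>" "x k \<omega>"] x_diff_xbar[of k \<omega>]
  by (simp add: norm_minus_commute mult.assoc)

definition mean_f :: "nat \<Rightarrow> real" where
  "mean_f k = (\<integral>\<omega>. f (xbar k \<omega>) \<partial>M)"

lemma f_xbar_integrable: "integrable M (\<lambda>\<omega>. f (xbar k \<omega>))"
  by (rule M.integrable_quadratic_growth[OF xbar_sq_integrable continuous_f, where d = "gradient f 0" and Q = "\<rho> / 2"])
    (use taylor_bound[of _ 0] in \<open>simp add: inner_commute\<close>)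

lemma xbar_0: "\<omega> \<in> space M \<Longrightarrow> xbar 0 \<omega> = x\<^sub>0"
  by (simp add: xbar_def z_prev_def x_0)

lemma objective_first_step:
  "mean_f 1 \<le> f x\<^sub>0 - \<alpha>\<^sub>0 * (1 - \<rho> * \<alpha>\<^sub>0 / 2) * grad_sq 0 + \<rho> / 2 * \<alpha>\<^sub>0\<^sup>2 * \<sigma>\<^sup>2"
proof -
  have "mean_f 0 = (\<integral>\<omega>. f x\<^sub>0 \<partial>M)"
    unfolding mean_f_def by (rule Bochner_Integration.integral_cong) (simp_all add: xbar_0)
  then have "mean_f 0 = f x\<^sub>0" by (simp add: M.prob_space)
  moreover have "(\<integral>\<omega>. gradient f (xbar 0 \<omega>) \<bullet> gradient f (x 0 \<omega>) \<partial>M) = grad_sq 0"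
    unfolding grad_sq_def
    by (rule Bochner_Integration.integral_cong) (simp_all add: xbar_0 x_0 power2_norm_eq_inner)
  ultimately show ?thesis
    using expected_descent[OF descent _ gradient_lipschitz f_xbar_integrable, of 0] rho
    by (simp add: mean_f_def weight_def algebra_simps power2_eq_square add_divide_distrib)
qed

text \<open>The gradient is taken at \<open>x\<^sub>k\<close>, not at the extrapolated point \<open>u\<close>. In
  \<open>2 \<nabla>f(u) \<bullet> \<nabla>f(x\<^sub>k) = |\<nabla>f(u)|\<^sup>2 + |\<nabla>f(x\<^sub>k)|\<^sup>2 - |\<nabla>f(u) - \<nabla>f(x\<^sub>k)|\<^sup>2\<close> only the second term is kept as
  a gain: this inequality serves to sum up \<open>|\<nabla>f(x\<^sub>k)|\<^sup>2\<close>.\<close>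

lemma objective_step:
  assumes "k > 0"
  defines "\<alpha> \<equiv> \<alpha>\<^sub>0 * \<beta>"
  shows "mean_f (Suc k) \<le> mean_f k - \<alpha> / 2 * (1 - \<rho> * \<alpha>) * grad_sq k
      + \<alpha> / 2 * (\<rho> * (\<alpha>\<^sub>0 * (1 - \<beta>)))\<^sup>2 * prev_mom_sq k + \<rho> / 2 * \<alpha>\<^sup>2 * \<sigma>\<^sup>2"
proof -
  let ?e = "\<rho> * (\<alpha>\<^sub>0 * (1 - \<beta>))"
  have \<alpha>: "\<alpha> > 0" using alpha0 beta by (simp add: \<alpha>_def)
  have u_sq: "sq_integrable M (\<lambda>\<omega>. gradient f (xbar k \<omega>))"
    by (rule M.sq_integrable_lipschitz[OF xbar_sq_integrable gradient_lipschitz])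
  have "grad_sq k / 2 - ?e\<^sup>2 * prev_mom_sq k / 2
      = (\<integral>\<omega>. (norm (gradient f (x k \<omega>)))\<^sup>2 / 2 - ?e\<^sup>2 * (norm (z_prev k \<omega>))\<^sup>2 / 2 \<partial>M)"
    using gradient_x_sq_integrable[of k] z_prev_sq_integrable[of k] by (simp add: sq_integrable_def grad_sq_def prev_mom_sq_def)
  also have "\<dots> \<le> (\<integral>\<omega>. gradient f (xbar k \<omega>) \<bullet> gradient f (x k \<omega>) \<partial>M)"
  proof (rule integral_mono)
    fix \<omega>
    let ?u = "gradient f (xbar k \<omega>)" and ?G = "gradient f (x k \<omega>)"
    have "(norm (?u - ?G))\<^sup>2 \<le> (?e * norm (z_prev k \<omega>))\<^sup>2"
      by (intro power_mono gradient_gap) simp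
    moreover have "(norm (?u - ?G))\<^sup>2 = (norm ?u)\<^sup>2 - 2 * (?u \<bullet> ?G) + (norm ?G)\<^sup>2"
      unfolding power2_norm_eq_inner by (simp add: inner_diff inner_commute)
    moreover have "0 \<le> (norm ?u)\<^sup>2" by simp
    ultimately show "(norm ?G)\<^sup>2 / 2 - ?e\<^sup>2 * (norm (z_prev k \<omega>))\<^sup>2 / 2 \<le> ?u \<bullet> ?G"
      unfolding power_mult_distrib[of ?e] by linarith
  qed (use gradient_x_sq_integrable[of k] z_prev_sq_integrable[of k] sq_integrable_inner[OF u_sq gradient_x_sq_integrable] in
      \<open>auto simp: sq_integrable_def\<close>)
  finally have "\<alpha> * (grad_sq k / 2 - ?e\<^sup>2 * prev_mom_sq k / 2)
      \<le> \<alpha> * (\<integral>\<omega>. gradient f (xbar k \<omega>) \<bullet> gradient f (x k \<omega>) \<partial>M)"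
    using \<alpha> by (intro mult_left_mono) auto
  moreover have "mean_f (Suc k) \<le> mean_f k - \<alpha> * (\<integral>\<omega>. gradient f (xbar k \<omega>) \<bullet> gradient f (x k \<omega>) \<partial>M)
      + \<rho> / 2 * \<alpha>\<^sup>2 * (grad_sq k + \<sigma>\<^sup>2)"
    using expected_descent[OF descent _ gradient_lipschitz f_xbar_integrable, of k] rho assms(1)
    by (simp add: mean_f_def weight_def \<alpha>_def)
  ultimately show ?thesis
    by (simp add: algebra_simps power2_eq_square add_divide_distrib diff_divide_distrib)
qed

lemma objective_sum:
  defines "\<alpha> \<equiv> \<alpha>\<^sub>0 * \<beta>"
  shows "mean_f (Suc N) + \<alpha> / 2 * (1 - \<rho> * \<alpha>) * (\<Sum>k=1..N. grad_sq k)
    \<le> mean_f 1 + \<alpha> / 2 * (\<rho> * (\<alpha>\<^sub>0 * (1 - \<beta>)))\<^sup>2 * (\<Sum>k<N. mom_sq k) + N * (\<rho> / 2 * \<alpha>\<^sup>2 * \<sigma>\<^sup>2)"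
proof (induction N)
  case (Suc N)
  then show ?case
    using objective_step[of "Suc N"] unfolding \<alpha>_def[symmetric] prev_mom_sq_Suc
    by (simp add: distrib_left distrib_right add_divide_distrib)
qed simp

end

section \<open>Descent of the Moreau envelope\<close>

locale heavy_ball_moreau = heavy_ball f \<rho> P M + smooth_moreau f \<rho>
  for f :: "real ^ 'n \<Rightarrow> real" and \<rho> and P :: "'s measure" and M :: "'w measure"
begin

definition mean_env :: "nat \<Rightarrow> real" where
  "mean_env k = (\<integral>\<omega>. moreau_envelope lam f (xbar k \<omega>) \<partial>M)"

definition env_grad_sq :: "nat \<Rightarrow> real" where
  "env_grad_sq k = (\<integral>\<omega>. (norm (grad_env (xbar k \<omega>)))\<^sup>2 \<partial>M)"

lemma moreau_xbar_integrable: "integrable M (\<lambda>\<omega>. moreau_envelope lam f (xbar k \<omega>))"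
  by (rule M.integrable_quadratic_growth[OF xbar_sq_integrable continuous_moreau, where d = "grad_env 0"])
    (use moreau_taylor_bound[of _ 0] in simp)

lemma grad_env_sq_integrable: "sq_integrable M (\<lambda>\<omega>. grad_env (xbar k \<omega>))"
  by (rule M.sq_integrable_lipschitz[OF xbar_sq_integrable grad_env_lipschitz])

text \<open>The inner product of \<open>\<nabla>F\<^sub>\<lambda>\<close> with \<open>\<nabla>f(x\<^sub>k)\<close> is compared with the one at the extrapolated point. Young's
  inequality charges the displacement by lowering the coefficient \<open>1 - \<rho> \<lambda>\<close> by \<open>1/8\<close>. This is the
  choice for which the leading noise terms in \<open>envelope_energy_bound\<close> balance at \<open>\<lambda> = 1/(2 \<rho>)\<close>.\<close>

lemma envelope_step:
  assumes "k > 0"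
  defines "\<alpha> \<equiv> \<alpha>\<^sub>0 * \<beta>"
  shows "mean_env (Suc k) \<le> mean_env k - \<alpha> * (7 / 8 - \<rho> * lam) * env_grad_sq k
      + 2 * \<alpha> * (\<rho> * (\<alpha>\<^sub>0 * (1 - \<beta>)))\<^sup>2 * prev_mom_sq k + (1 / lam) / 2 * \<alpha>\<^sup>2 * (grad_sq k + \<sigma>\<^sup>2)"
proof -
  let ?e = "\<rho> * (\<alpha>\<^sub>0 * (1 - \<beta>))"
  have \<alpha>: "\<alpha> > 0" using alpha0 beta by (simp add: \<alpha>_def)
  have "(7 / 8 - \<rho> * lam) * env_grad_sq k - 2 * ?e\<^sup>2 * prev_mom_sq k
      = (\<integral>\<omega>. (7 / 8 - \<rho> * lam) * (norm (grad_env (xbar k \<omega>)))\<^sup>2 - 2 * ?e\<^sup>2 * (norm (z_prev k \<omega>))\<^sup>2 \<partial>M)"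
    using grad_env_sq_integrable[of k] z_prev_sq_integrable[of k] by (simp add: sq_integrable_def env_grad_sq_def prev_mom_sq_def)
  also have "\<dots> \<le> (\<integral>\<omega>. grad_env (xbar k \<omega>) \<bullet> gradient f (x k \<omega>) \<partial>M)"
  proof (rule integral_mono)
    fix \<omega>
    let ?D = "grad_env (xbar k \<omega>)" and ?u = "gradient f (xbar k \<omega>)" and ?G = "gradient f (x k \<omega>)"
    define d where "d = norm ?D"
    define e where "e = ?e * norm (z_prev k \<omega>)"
    have "\<bar>?D \<bullet> (?u - ?G)\<bar> \<le> d * norm (?u - ?G)"
      unfolding d_def by (rule Cauchy_Schwarz_ineq2)
    also have "\<dots> \<le> d * e"
      unfolding d_def e_def by (intro mult_left_mono gradient_gap) simp
    finally have "?D \<bullet> ?u - d * e \<le> ?D \<bullet> ?G" by (simp add: inner_diff_right)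
    moreover have "(1 - \<rho> * lam) * d\<^sup>2 \<le> ?D \<bullet> ?u"
      unfolding d_def by (rule inner_grad_env_gradient_ge)
    moreover have "d * e \<le> d\<^sup>2 / 8 + 2 * e\<^sup>2"
      using zero_le_power2[of "d - 4 * e"] by (simp add: power2_diff)
    moreover have "(1 - \<rho> * lam) * d\<^sup>2 = (7 / 8 - \<rho> * lam) * d\<^sup>2 + d\<^sup>2 / 8"
      by (simp add: algebra_simps)
    ultimately have "(7 / 8 - \<rho> * lam) * d\<^sup>2 - 2 * e\<^sup>2 \<le> ?D \<bullet> ?G" by linarith
    then show "(7 / 8 - \<rho> * lam) * (norm ?D)\<^sup>2 - 2 * ?e\<^sup>2 * (norm (z_prev k \<omega>))\<^sup>2 \<le> ?D \<bullet> ?G"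
      by (simp add: d_def e_def power_mult_distrib)
  qed (use grad_env_sq_integrable[of k] z_prev_sq_integrable[of k] sq_integrable_inner[OF grad_env_sq_integrable gradient_x_sq_integrable] in
      \<open>auto simp: sq_integrable_def\<close>)
  finally have "\<alpha> * ((7 / 8 - \<rho> * lam) * env_grad_sq k - 2 * ?e\<^sup>2 * prev_mom_sq k)
      \<le> \<alpha> * (\<integral>\<omega>. grad_env (xbar k \<omega>) \<bullet> gradient f (x k \<omega>) \<partial>M)"
    using \<alpha> by (intro mult_left_mono) auto
  moreover have "\<alpha> * ((7 / 8 - \<rho> * lam) * env_grad_sq k - 2 * ?e\<^sup>2 * prev_mom_sq k)
      = \<alpha> * (7 / 8 - \<rho> * lam) * env_grad_sq k - 2 * \<alpha> * ?e\<^sup>2 * prev_mom_sq k" by (simp add: right_diff_distrib)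
  moreover have "mean_env (Suc k) \<le> mean_env k
      - \<alpha> * (\<integral>\<omega>. grad_env (xbar k \<omega>) \<bullet> gradient f (x k \<omega>) \<partial>M)
      + (1 / lam) / 2 * \<alpha>\<^sup>2 * (grad_sq k + \<sigma>\<^sup>2)"
    using expected_descent[OF moreau_descent _ grad_env_lipschitz moreau_xbar_integrable, of k] lam assms(1)
    by (simp add: mean_env_def weight_def \<alpha>_def)
  ultimately show ?thesis by linarith
qed

lemma envelope_sum:
  defines "\<alpha> \<equiv> \<alpha>\<^sub>0 * \<beta>"
  shows "mean_env (Suc N) + \<alpha> * (7 / 8 - \<rho> * lam) * (\<Sum>k=1..N. env_grad_sq k)
    \<le> mean_env 1 + 2 * \<alpha> * (\<rho> * (\<alpha>\<^sub>0 * (1 - \<beta>)))\<^sup>2 * (\<Sum>k<N. mom_sq k)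
      + (1 / lam) / 2 * \<alpha>\<^sup>2 * ((\<Sum>k=1..N. grad_sq k) + N * \<sigma>\<^sup>2)"
proof (induction N)
  case (Suc N)
  have "mean_env (Suc (Suc N)) + \<alpha> * (7 / 8 - \<rho> * lam) * (\<Sum>k=1..N. env_grad_sq k) + \<alpha> * (7 / 8 - \<rho> * lam) * env_grad_sq (Suc N)
    \<le> mean_env 1 + 2 * \<alpha> * (\<rho> * (\<alpha>\<^sub>0 * (1 - \<beta>)))\<^sup>2 * (\<Sum>k<N. mom_sq k)
      + 2 * \<alpha> * (\<rho> * (\<alpha>\<^sub>0 * (1 - \<beta>)))\<^sup>2 * mom_sq N
      + (1 / lam) / 2 * \<alpha>\<^sup>2 * ((\<Sum>k=1..N. grad_sq k) + N * \<sigma>\<^sup>2)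
      + (1 / lam) / 2 * \<alpha>\<^sup>2 * (grad_sq (Suc N) + \<sigma>\<^sup>2)"
    using envelope_step[of "Suc N"] Suc unfolding \<alpha>_def[symmetric] prev_mom_sq_Suc by linarith
  then show ?case by (simp add: distrib_left distrib_right add_ac)
qed simp

end

section \<open>The bookkeeping of the constants\<close>

text \<open>Here \<open>r = \<rho> \<alpha>\<^sub>0\<close>, \<open>Y = \<alpha>\<^sub>0 \<sigma>\<^sup>2\<close>, \<open>q = \<alpha>\<^sub>0 |\<nabla>f(x\<^sub>0)|\<^sup>2\<close>, and \<open>S\<close>, \<open>Z\<close> are \<open>\<alpha>\<close> times the sums of the
  expected squares of \<open>\<nabla>f(x\<^sub>k)\<close> and \<open>z\<^sub>k\<close>. The two assumed inequalities bound each sum by the other, but the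
  loop has gain of order \<open>r\<^sup>2 \<le> 1/16\<close> and closes. The noise in the bound for \<open>S\<close> keeps its factor
  \<open>r\<close>; losing it would spoil the final constant for small \<open>\<alpha>\<^sub>0\<close>.\<close>

lemma momentum_energy_bounds:
  fixes r b \<Delta> Y q S Z :: real
  assumes r: "0 \<le> r" "r \<le> 1 / 4" and b: "0 \<le> b" "b \<le> 1"
    and nonneg: "0 \<le> \<Delta>" "0 \<le> Y" "0 \<le> q" "0 \<le> S" "0 \<le> Z"
    and S: "(1 - r * b) / 2 * S \<le> \<Delta> - (1 - r / 2) * q + r * Y + (r * (1 - b))\<^sup>2 / 2 * Z"
    and Z: "Z \<le> q + 2 * Y + S"
  shows "Z \<le> 3 * (\<Delta> + Y)" "S \<le> 3 * \<Delta> + 4 * (r * Y)"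
proof -
  have rb: "r * b \<le> 1 / 4" using mult_mono[of r "1/4" b 1] r b by simp
  have "(r * (1 - b))\<^sup>2 \<le> r\<^sup>2"
    using r b by (intro power_mono) (auto intro: mult_left_le)
  then have rbZ: "(r * (1 - b))\<^sup>2 * Z \<le> r\<^sup>2 * Z" using nonneg by (intro mult_right_mono)
  have "r * r \<le> 1 / 4 * r" using r by (intro mult_right_mono)
  then have r2: "r\<^sup>2 \<le> r / 4" "r\<^sup>2 \<le> 1 / 16" using r by (auto simp: power2_eq_square)
  have "3 / 8 * S \<le> (1 - r * b) / 2 * S" using rb nonneg by (intro mult_right_mono) auto
  moreover have "7 / 8 * q \<le> (1 - r / 2) * q" using r nonneg by (intro mult_right_mono) auto
  moreover have "(r * (1 - b))\<^sup>2 / 2 * Z \<le> r\<^sup>2 * Z / 2" using rbZ by simp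
  ultimately have main: "3 / 8 * S \<le> \<Delta> - 7 / 8 * q + r * Y + r\<^sup>2 * Z / 2" using S by linarith
  define E where "E = r\<^sup>2 * Z"
  have "E \<le> 1 / 16 * Z" "r * Y \<le> 1 / 4 * Y"
    unfolding E_def using r r2 nonneg by (intro mult_right_mono; simp)+
  with main[folded E_def] Z nonneg show Z3: "Z \<le> 3 * (\<Delta> + Y)" by argo
  have "r\<^sup>2 * Z \<le> r\<^sup>2 * (3 * (\<Delta> + Y))" using Z3 by (intro mult_left_mono) auto
  also have "\<dots> = 3 * (r\<^sup>2 * \<Delta>) + 3 * (r\<^sup>2 * Y)" by (simp add: algebra_simps)
  also have "r\<^sup>2 * \<Delta> \<le> 1 / 16 * \<Delta>" using r2 nonneg by (intro mult_right_mono)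
  also have "r\<^sup>2 * Y \<le> r / 4 * Y" using r2 nonneg by (intro mult_right_mono)
  finally have "E \<le> 3 / 16 * \<Delta> + 3 / 4 * (r * Y)" unfolding E_def by simp
  with main[folded E_def] nonneg mult_nonneg_nonneg[OF r(1) nonneg(2)]
  show "S \<le> 3 * \<Delta> + 4 * (r * Y)" by argo
qed

text \<open>Here \<open>l = 1/(\<rho> \<lambda>)\<close>, \<open>D\<close> is \<open>\<alpha>\<close> times the sum of \<open>E |\<nabla>F\<^sub>\<lambda>|\<^sup>2\<close> over the extrapolated points of index
  at least \<open>1\<close>, and \<open>d\<close> the contribution of the two copies of \<open>x\<^sub>0\<close>. Multiplying by
  \<open>\<kappa> = 7/8 - 1/l\<close> leaves two scalar inequalities, one for the coefficient of \<open>\<Delta>\<close> and one for that of the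
  noise \<open>r Y\<close>. In the latter the leading terms compare \<open>1/2\<close> (first step, measured with \<open>f\<close>) plus \<open>l/2\<close>
  (later steps, measured with the envelope) to \<open>\<gamma> l/2\<close>; this amounts to \<open>(2 - l)(l + 6) \<ge> 0\<close>, with
  equality at \<open>\<lambda> = 1/(2 \<rho>)\<close>. All other noise terms carry a further factor \<open>r\<close> and are absorbed by
  \<open>8 r l\<close>.\<close>

lemma envelope_energy_bound:
  fixes l r b \<Delta> Y S Z d D :: real
  assumes l: "3 / 2 < l" "l \<le> 2" and r: "0 \<le> r" "r \<le> 1 / 4" and b: "0 \<le> b" "b \<le> 3 / 5"
    and nonneg: "0 \<le> \<Delta>" "0 \<le> Y" "0 \<le> d"
    and Z: "Z \<le> 3 * (\<Delta> + Y)" and S: "S \<le> 3 * \<Delta> + 4 * (r * Y)"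
    and D: "(7 / 8 - 1 / l) * D \<le> \<Delta> + r * Y / 2 + l / 2 * (r * b * S + r * Y) + 2 * (r\<^sup>2 * (1 - b)) * Z"
    and d: "(1 + 1 / l) * d \<le> 4 * r * b * \<Delta>"
  shows "d + D \<le> 2 * l / (2 * l - 3) * ((1 + 2 * r\<^sup>2 * l\<^sup>2) * \<Delta> + (1 + 8 * (r * l)) * (l / 2) * (r * Y))"
proof -
  define \<kappa> where "\<kappa> = 7 / 8 - 1 / l"
  define \<gamma> where "\<gamma> = (7 * l / 4 - 2) / (2 * l - 3)"
  have l0: "l > 0" "2 * l - 3 > 0" using l by auto
  have \<kappa>: "\<kappa> > 0" using l by (simp add: \<kappa>_def field_simps)
  have \<gamma>: "\<kappa> * (2 * l / (2 * l - 3)) = \<gamma>" using l0 by (simp add: \<kappa>_def \<gamma>_def field_simps)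
  have factor: "(k * c * A) * u + (k * c * B) * v = k * (c * (A * u + B * v))" for k c A B u v :: real
    by (simp add: algebra_simps)
  have rb: "0 \<le> r * b" and rY: "0 \<le> r * Y" and r2b: "0 \<le> r\<^sup>2 * (1 - b)" using r b nonneg by auto
  have "\<kappa> \<le> (1 + 1 / l) / 4" using l by (simp add: \<kappa>_def field_simps)
  then have "\<kappa> * d \<le> (1 + 1 / l) / 4 * d" using nonneg by (intro mult_right_mono)
  then have d': "\<kappa> * d \<le> r * b * \<Delta>" using d by simp
  have lS: "l / 2 * (r * b * S) \<le> l / 2 * (r * b * (3 * \<Delta> + 4 * (r * Y)))"
    using S rb l0 by (intro mult_left_mono) auto
  have lD: "l / 2 * (r * b * (3 * \<Delta> + 4 * (r * Y))) \<le> 1 * (r * b * (3 * \<Delta> + 4 * (r * Y)))"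
    using l nonneg rY by (intro mult_right_mono mult_nonneg_nonneg[OF rb]) auto
  have rZ: "2 * (r\<^sup>2 * (1 - b)) * Z \<le> 2 * (r\<^sup>2 * (1 - b)) * (3 * (\<Delta> + Y))"
    using Z r2b by (intro mult_left_mono) auto
  have "\<kappa> * (d + D) \<le> r * b * \<Delta> + \<Delta> + r * Y / 2 + (r * b * (3 * \<Delta> + 4 * (r * Y)) + l / 2 * (r * Y))
      + 2 * (r\<^sup>2 * (1 - b)) * (3 * (\<Delta> + Y))"
    using d' lS lD rZ D unfolding \<kappa>_def[symmetric] distrib_left[of "l / 2"] distrib_left[of \<kappa>] by linarith
  also have "\<dots> = (1 + 4 * (r * b) + 6 * (r\<^sup>2 * (1 - b))) * \<Delta>
      + (1 / 2 + l / 2 + 4 * (r * b) + 6 * (r * (1 - b))) * (r * Y)"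
    by (simp add: field_simps power2_eq_square)
  also have "\<dots> \<le> (\<gamma> * (1 + 2 * r\<^sup>2 * l\<^sup>2)) * \<Delta> + (\<gamma> * ((1 + 8 * (r * l)) * (l / 2))) * (r * Y)"
  proof (intro add_mono mult_right_mono nonneg rY)
    have "3 / 2 \<le> \<gamma>" using l by (simp add: \<gamma>_def field_simps)
    moreover have "9 / 4 \<le> l\<^sup>2" using power_mono[of "3/2" l 2] l by (simp add: power2_eq_square)
    then have "2 * r\<^sup>2 * (9 / 4) \<le> 2 * r\<^sup>2 * l\<^sup>2" by (intro mult_left_mono) auto
    ultimately have "3 / 2 * (1 + 9 / 2 * r\<^sup>2) \<le> \<gamma> * (1 + 2 * r\<^sup>2 * l\<^sup>2)" by (intro mult_mono) auto
    moreover have "1 + 4 * (r * b) + 6 * (r\<^sup>2 * (1 - b)) \<le> 3 / 2 * (1 + 9 / 2 * r\<^sup>2)"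
    proof -
      have "r * r \<le> 1 / 4 * r" using r by (intro mult_right_mono)
      then have "0 \<le> 4 * r - 6 * r\<^sup>2" using r by (simp add: power2_eq_square)
      then have "b * (4 * r - 6 * r\<^sup>2) \<le> 3 / 5 * (4 * r - 6 * r\<^sup>2)" using b by (intro mult_right_mono)
      then have "4 * (r * b) + 6 * (r\<^sup>2 * (1 - b)) \<le> 12 / 5 * r + 12 / 5 * r\<^sup>2"
        by (simp add: algebra_simps)
      \<comment> \<open>The tangent of \<open>r\<^sup>2\<close> at \<open>2/7\<close>, close to the minimum of \<open>1/2 - 12/5 r + 87/20 r\<^sup>2\<close>.\<close>
      moreover have "r\<^sup>2 \<ge> 4 / 7 * r - 4 / 49"
        using zero_le_power2[of "r - 2 / 7"] by (simp add: power2_diff power_divide)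
      ultimately show ?thesis using r by argo
    qed
    ultimately show "1 + 4 * (r * b) + 6 * (r\<^sup>2 * (1 - b)) \<le> \<gamma> * (1 + 2 * r\<^sup>2 * l\<^sup>2)" by linarith
  next
    have "0 \<le> (2 - l) * (l + 6)" using l by (intro mult_nonneg_nonneg) auto
    then have base: "1 / 2 + l / 2 \<le> \<gamma> * (l / 2)"
      using l by (simp add: \<gamma>_def field_simps)
    have "(1 / 2 + l / 2) * (8 * l) \<ge> (1 / 2 + 1 / 4) * (8 * 1)" using l by (intro mult_mono) auto
    then have "6 * r \<le> (1 / 2 + l / 2) * (8 * l) * r" using r by (intro mult_right_mono) auto
    also have "\<dots> = (1 / 2 + l / 2) * (8 * (r * l))" by simp
    also have "\<dots> \<le> \<gamma> * (l / 2) * (8 * (r * l))" using base r l by (intro mult_right_mono) auto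
    finally have "6 * r \<le> \<gamma> * (l / 2) * (8 * (r * l))" .
    moreover have "4 * (r * b) + 6 * (r * (1 - b)) \<le> 6 * r" using rb by (simp add: algebra_simps)
    moreover have "\<gamma> * ((1 + 8 * (r * l)) * (l / 2)) = \<gamma> * (l / 2) + \<gamma> * (l / 2) * (8 * (r * l))"
      by (simp add: algebra_simps)
    ultimately show "1 / 2 + l / 2 + 4 * (r * b) + 6 * (r * (1 - b)) \<le> \<gamma> * ((1 + 8 * (r * l)) * (l / 2))"
      using base by linarith
  qed
  also have "\<dots> = \<kappa> * (2 * l / (2 * l - 3) * ((1 + 2 * r\<^sup>2 * l\<^sup>2) * \<Delta> + (1 + 8 * (r * l)) * (l / 2) * (r * Y)))"
    unfolding \<gamma>[symmetric] by (rule factor)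
  finally show ?thesis using \<kappa> by (simp only: mult_le_cancel_left_pos)
qed

section \<open>The bound for the random iterate\<close>

text \<open>If \<open>f\<close> is unbounded below, the gap and hence the right-hand side is infinite; otherwise the
  infimum is itself a lower bound \<open>m\<close>.\<close>

lemma ereal_bound_by_gap:
  assumes bound: "\<And>m. (\<And>v. m \<le> f v) \<Longrightarrow> X \<le> c * ((A * (f u - m) + B) / C)"
    and pos: "0 < c" "0 < A" "0 < C"
  shows "ereal X \<le> ereal c * ((ereal A * optimality_gap f u + ereal B) / ereal C)"
proof (cases "INF v. ereal (f v)")
  case (real m)
  have "m \<le> f v" for v
    using INF_lower[of v UNIV "\<lambda>v. ereal (f v)"] real by simp
  from bound[OF this] show ?thesis using pos by (simp add: optimality_gap_def real)
next
  case PInf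
  then show ?thesis using INF_lower[of u UNIV "\<lambda>v. ereal (f v)"] by simp
next
  case MInf
  then show ?thesis using pos by (simp add: optimality_gap_def)
qed

context heavy_ball_moreau
begin

text \<open>The value \<open>x\<^sub>0\<close> is counted twice, for the indices \<open>-1\<close> and \<open>0\<close>. For \<open>K \<le> 1\<close> no other point occurs. For
  \<open>K \<ge> 2\<close> the momentum parameter is at most \<open>1 / sqrt 3 \<le> 3/5\<close>, which keeps the coefficient of the gap
  below the one that is claimed.\<close>

lemma gradient_sum_bound:
  fixes K :: nat
  assumes lower: "\<And>v. m \<le> f v" and L: "3 * \<rho> / 2 < 1 / lam" "1 / lam \<le> 2 * \<rho>"
    and step: "\<alpha>\<^sub>0 \<le> 1 / (4 * \<rho>)" and \<beta>: "\<beta> = 1 / sqrt (real K + 1)"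
  shows "\<alpha>\<^sub>0 * \<beta> * (env_grad_sq 0 + (\<Sum>k<K. env_grad_sq k))
    \<le> 2 * (1 / lam) / (2 * (1 / lam) - 3 * \<rho>) * ((1 + 2 * \<alpha>\<^sub>0\<^sup>2 / lam\<^sup>2) * (f x\<^sub>0 - m)
        + (1 + 8 * \<alpha>\<^sub>0 / lam) * \<sigma>\<^sup>2 * \<alpha>\<^sub>0\<^sup>2 / (2 * lam))"
proof -
  define l r Y \<Delta> where "l = 1 / (\<rho> * lam)" and "r = \<rho> * \<alpha>\<^sub>0" and "Y = \<alpha>\<^sub>0 * \<sigma>\<^sup>2" and "\<Delta> = f x\<^sub>0 - m"
  have l: "3 / 2 < l" "l \<le> 2"
    using L rho lam by (simp_all add: l_def field_simps)
  have r: "0 \<le> r" "r \<le> 1 / 4"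
    using step rho alpha0 by (simp_all add: r_def field_simps)
  have Y: "0 \<le> Y" and \<Delta>: "0 \<le> \<Delta>" using alpha0 lower[of x\<^sub>0] by (simp_all add: Y_def \<Delta>_def)
  have l_inv: "\<rho> * lam = 1 / l" "1 / lam = l * \<rho>" using rho by (simp_all add: l_def)
  have l0: "l > 0" using l by simp
  have rhs: "2 * (1 / lam) / (2 * (1 / lam) - 3 * \<rho>) * ((1 + 2 * \<alpha>\<^sub>0\<^sup>2 / lam\<^sup>2) * (f x\<^sub>0 - m)
        + (1 + 8 * \<alpha>\<^sub>0 / lam) * \<sigma>\<^sup>2 * \<alpha>\<^sub>0\<^sup>2 / (2 * lam))
      = 2 * l / (2 * l - 3) * ((1 + 2 * r\<^sup>2 * l\<^sup>2) * \<Delta> + (1 + 8 * (r * l)) * (l / 2) * (r * Y))"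
  proof -
    have "2 * (1 / lam) / (2 * (1 / lam) - 3 * \<rho>) = (\<rho> * (2 * l)) / (\<rho> * (2 * l - 3))"
      unfolding l_inv by (simp add: algebra_simps)
    also have "\<dots> = 2 * l / (2 * l - 3)" using rho by (intro mult_divide_mult_cancel_left) simp
    finally have c: "2 * (1 / lam) / (2 * (1 / lam) - 3 * \<rho>) = 2 * l / (2 * l - 3)" .
    have "2 * \<alpha>\<^sub>0\<^sup>2 / lam\<^sup>2 = 2 * r\<^sup>2 * l\<^sup>2" "8 * \<alpha>\<^sub>0 / lam = 8 * (r * l)"
      "(1 + 8 * \<alpha>\<^sub>0 / lam) * \<sigma>\<^sup>2 * \<alpha>\<^sub>0\<^sup>2 / (2 * lam) = (1 + 8 * \<alpha>\<^sub>0 / lam) * (l / 2) * (r * Y)"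
      using rho lam by (simp_all add: r_def l_def Y_def power2_eq_square mult_ac)
    then show ?thesis unfolding c \<Delta>_def by simp
  qed
  have b: "0 \<le> \<beta>" "\<beta> \<le> 1" using beta by auto
  have \<alpha>: "0 < \<alpha>\<^sub>0 * \<beta>" using alpha0 beta by simp
  have env_grad_sq_0: "env_grad_sq 0 = (norm (grad_env x\<^sub>0))\<^sup>2"
  proof -
    have "env_grad_sq 0 = (\<integral>\<omega>. (norm (grad_env x\<^sub>0))\<^sup>2 \<partial>M)"
      unfolding env_grad_sq_def by (rule Bochner_Integration.integral_cong) (simp_all add: xbar_0)
    then show ?thesis by (simp add: M.prob_space)
  qed
  define d where "d = 2 * (\<alpha>\<^sub>0 * \<beta>) * env_grad_sq 0"
  have d0: "0 \<le> d" using \<alpha> by (simp add: d_def env_grad_sq_0)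
  have "(1 + 1 / l) * env_grad_sq 0 \<le> 2 * \<rho> * \<Delta>"
    using grad_env_sq_le_gap[OF lower, of x\<^sub>0] by (simp add: env_grad_sq_0 l_inv \<Delta>_def)
  from mult_left_mono[OF this, of "2 * (\<alpha>\<^sub>0 * \<beta>)"] \<alpha>
  have d: "(1 + 1 / l) * d \<le> 4 * r * \<beta> * \<Delta>"
    by (simp add: d_def r_def algebra_simps)
  show ?thesis
  proof (cases "K \<le> 1")
    case True
    have "env_grad_sq 0 + (\<Sum>k<K. env_grad_sq k) \<le> 2 * env_grad_sq 0"
      using True by (cases K) (auto simp: env_grad_sq_0)
    from mult_left_mono[OF this, of "\<alpha>\<^sub>0 * \<beta>"] \<alpha>
    have "\<alpha>\<^sub>0 * \<beta> * (env_grad_sq 0 + (\<Sum>k<K. env_grad_sq k)) \<le> d" by (simp add: d_def)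
    also have "d \<le> (1 + 1 / l) * d" using d0 l0 by (simp add: distrib_right)
    also have "\<dots> \<le> 4 * r * \<beta> * \<Delta>" by (rule d)
    also have "\<dots> \<le> 1 * \<Delta>"
      using mult_mono[of "4 * r" 1 \<beta> 1] r b \<Delta> by (intro mult_right_mono) auto
    also have "\<dots> \<le> 2 * l / (2 * l - 3) * ((1 + 2 * r\<^sup>2 * l\<^sup>2) * \<Delta> + (1 + 8 * (r * l)) * (l / 2) * (r * Y))"
    proof (rule mult_mono)
      show "1 \<le> 2 * l / (2 * l - 3)" using l by (simp add: field_simps)
      have "1 * \<Delta> \<le> (1 + 2 * r\<^sup>2 * l\<^sup>2) * \<Delta>" using \<Delta> by (intro mult_right_mono) auto
      moreover have "0 \<le> (1 + 8 * (r * l)) * (l / 2) * (r * Y)" using r l0 Y by simp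
      ultimately show "\<Delta> \<le> (1 + 2 * r\<^sup>2 * l\<^sup>2) * \<Delta> + (1 + 8 * (r * l)) * (l / 2) * (r * Y)" by linarith
    qed (use \<Delta> l in auto)
    finally show ?thesis unfolding rhs .
  next
    case False
    then obtain N where N: "K = Suc N" "N > 0" by (cases K) auto
    have "5 / 3 \<le> sqrt 3" by (rule real_le_rsqrt) (simp add: power2_eq_square)
    moreover have "sqrt 3 \<le> sqrt (real K + 1)" using False by simp
    ultimately have "5 / 3 \<le> sqrt (real K + 1)" by (rule order_trans)
    then have "1 / sqrt (real K + 1) \<le> 1 / (5 / 3)" by (intro frac_le) auto
    then have b35: "\<beta> \<le> 3 / 5" unfolding \<beta> by simp
    \<comment> \<open>The \<open>N\<close> later steps together carry no more noise than the first one.\<close>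
    have "\<beta>\<^sup>2 = 1 / (real K + 1)" unfolding \<beta> by (simp add: power_divide)
    then have Nb: "real N * \<beta>\<^sup>2 \<le> 1" using N by simp
    define q S Z where "q = \<alpha>\<^sub>0 * grad_sq 0" and "S = \<alpha>\<^sub>0 * \<beta> * (\<Sum>k=1..N. grad_sq k)"
      and "Z = \<alpha>\<^sub>0 * \<beta> * (\<Sum>k<N. mom_sq k)"
    define D where "D = \<alpha>\<^sub>0 * \<beta> * (\<Sum>k=1..N. env_grad_sq k)"
    have nonneg: "0 \<le> q" "0 \<le> S" "0 \<le> Z"
      using alpha0 beta
      by (auto simp: q_def S_def Z_def grad_sq_def mom_sq_def intro!: mult_nonneg_nonneg sum_nonneg integral_nonneg)
    have rY: "0 \<le> r * Y" using r Y by simp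
    have NY: "real N * \<beta>\<^sup>2 * Y \<le> 1 * Y" "real N * \<beta>\<^sup>2 * (r * Y) \<le> 1 * (r * Y)"
      by (rule mult_right_mono[OF Nb Y], rule mult_right_mono[OF Nb rY])
    have f_ge: "m \<le> mean_f k" for k
    proof -
      have "(\<integral>\<omega>. m \<partial>M) \<le> mean_f k"
        unfolding mean_f_def by (rule integral_mono) (use f_xbar_integrable lower in auto)
      then show ?thesis by (simp add: M.prob_space)
    qed
    have env_ge: "m \<le> mean_env k" for k
    proof -
      have "m \<le> moreau_envelope lam f u" for u
        unfolding moreau_eq using lower[of "prox u"] lam by (simp add: add_increasing2)
      then have "(\<integral>\<omega>. m \<partial>M) \<le> mean_env k"
        unfolding mean_env_def by (intro integral_mono) (use moreau_xbar_integrable in auto)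
      then show ?thesis by (simp add: M.prob_space)
    qed
    have first: "mean_f 1 \<le> f x\<^sub>0 - (1 - r / 2) * q + r * Y / 2"
      using objective_first_step by (simp add: q_def r_def Y_def power2_eq_square algebra_simps)
    have "mean_f (Suc N) + (1 - r * \<beta>) / 2 * S \<le> mean_f 1 + (r * (1 - \<beta>))\<^sup>2 / 2 * Z + real N * \<beta>\<^sup>2 * (r * Y) / 2"
      using objective_sum[of N] by (simp add: S_def Z_def r_def Y_def power2_eq_square mult_ac)
    then have "(1 - r * \<beta>) / 2 * S \<le> \<Delta> - (1 - r / 2) * q + r * Y + (r * (1 - \<beta>))\<^sup>2 / 2 * Z"
      using first NY(2) f_ge[of "Suc N"] unfolding \<Delta>_def by linarith
    moreover have "Z \<le> q + 2 * Y + S"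
    proof -
      have "0 \<le> mom_sq N" by (simp add: mom_sq_def)
      with momentum_sum[of N]
      have "\<beta> * (\<Sum>k<N. mom_sq k) \<le> grad_sq 0 + \<sigma>\<^sup>2 + \<beta> * (\<Sum>k=1..N. grad_sq k) + N * (\<beta>\<^sup>2 * \<sigma>\<^sup>2)" by linarith
      from mult_left_mono[OF this, of \<alpha>\<^sub>0] alpha0
      have "Z \<le> q + Y + S + real N * \<beta>\<^sup>2 * Y"
        by (simp add: Z_def q_def Y_def S_def distrib_left mult_ac)
      with NY(1) show ?thesis by linarith
    qed
    ultimately have ZS: "Z \<le> 3 * (\<Delta> + Y)" "S \<le> 3 * \<Delta> + 4 * (r * Y)"
      using momentum_energy_bounds[OF r b \<Delta> Y nonneg] by auto
    \<comment> \<open>The first step is long, so it is measured with \<open>f\<close>, whose curvature constant \<open>\<rho>\<close> is smaller than \<open>1/lam\<close>.\<close>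
    have "mean_env 1 \<le> mean_f 1"
      unfolding mean_env_def mean_f_def
      by (intro integral_mono moreau_xbar_integrable f_xbar_integrable moreau_le_f)
    moreover have "0 \<le> (1 - r / 2) * q" using r nonneg by simp
    moreover have "mean_env (Suc N) + (7 / 8 - 1 / l) * D
        \<le> mean_env 1 + 2 * (r * (1 - \<beta>))\<^sup>2 * Z + l / 2 * (r * \<beta> * S + real N * \<beta>\<^sup>2 * (r * Y))"
      using envelope_sum[of N] unfolding l_inv
      by (simp add: D_def Z_def S_def r_def Y_def power2_eq_square algebra_simps)
    moreover have "l / 2 * (r * \<beta> * S + real N * \<beta>\<^sup>2 * (r * Y)) \<le> l / 2 * (r * \<beta> * S + r * Y)"
      using NY(2) l0 by (intro mult_left_mono) auto
    moreover have "2 * (r * (1 - \<beta>))\<^sup>2 * Z \<le> 2 * (r\<^sup>2 * (1 - \<beta>)) * Z"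
    proof -
      have "(1 - \<beta>)\<^sup>2 \<le> 1 - \<beta>" using b mult_left_le[of "1 - \<beta>" "1 - \<beta>"] by (simp add: power2_eq_square)
      then have "r\<^sup>2 * (1 - \<beta>)\<^sup>2 \<le> r\<^sup>2 * (1 - \<beta>)" by (intro mult_left_mono) auto
      then show ?thesis using nonneg by (simp add: power_mult_distrib mult_right_mono)
    qed
    ultimately have "(7 / 8 - 1 / l) * D
        \<le> \<Delta> + r * Y / 2 + l / 2 * (r * \<beta> * S + r * Y) + 2 * (r\<^sup>2 * (1 - \<beta>)) * Z"
      using env_ge[of "Suc N"] first unfolding \<Delta>_def by linarith
    from envelope_energy_bound[OF l r b(1) b35 \<Delta> Y d0 ZS this d]
    have "d + D \<le> 2 * l / (2 * l - 3) * ((1 + 2 * r\<^sup>2 * l\<^sup>2) * \<Delta> + (1 + 8 * (r * l)) * (l / 2) * (r * Y))" .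
    moreover have "\<alpha>\<^sub>0 * \<beta> * (env_grad_sq 0 + (\<Sum>k<K. env_grad_sq k)) = d + D"
    proof -
      have "(\<Sum>k<K. env_grad_sq k) = env_grad_sq 0 + (\<Sum>k=1..N. env_grad_sq k)"
        unfolding N(1) sum.lessThan_Suc_shift
        by (simp add: sum.shift_bounds_Suc_ivl atLeastLessThanSuc_atLeastAtMost lessThan_atLeast0
            flip: sum.shift_bounds_Suc_ivl)
      then show ?thesis by (simp add: d_def D_def algebra_simps)
    qed
    ultimately show ?thesis unfolding rhs by simp
  qed
qed

lemma extrapolated_eq_xbar:
  assumes "\<omega> \<in> space M"
  shows "extrapolated \<beta> (\<lambda>k. x k \<omega>) j = xbar (nat j) \<omega>"
proof (cases "j \<le> 0")
  case True
  then show ?thesis using assms by (simp add: extrapolated_def xbar_0 x_0)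
next
  case False
  then obtain n where n: "nat j = Suc n" "nat (j - 1) = n"
    by (metis Suc_nat_eq_nat_zadd1 add.commute diff_add_cancel int_one_le_iff_zero_less
        linorder_not_le nat_diff_distrib' zle_diff1_eq nat_0_le)
  have "((1 - \<beta>) / \<beta>) *\<^sub>R (x (Suc n) \<omega> - x n \<omega>) = - (\<alpha>\<^sub>0 * (1 - \<beta>)) *\<^sub>R z n \<omega>"
    using beta by (simp add: x_Suc[OF assms] mult.commute)
  then show ?thesis using False by (simp add: extrapolated_def n xbar_def z_prev_def)
qed

lemma random_iterate_bound:
  fixes K :: nat and \<kappa> :: "'w \<Rightarrow> int"
  assumes L: "3 * \<rho> / 2 < 1 / lam" "1 / lam \<le> 2 * \<rho>"
    and step: "\<alpha>\<^sub>0 \<le> 1 / (4 * \<rho>)" and \<beta>: "\<beta> = 1 / sqrt (real K + 1)"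
    and \<kappa>: "\<kappa> \<in> M \<rightarrow>\<^sub>M count_space UNIV"
    and distr: "distr M (count_space UNIV) \<kappa> = measure_pmf (pmf_of_set {-1 .. int K - 1})"
    and indep: "M.indep_set (sets (vimage_algebra (space M) \<kappa> (count_space UNIV)))
         (sets (vimage_algebra (space M) (\<lambda>\<omega> k. S k \<omega>) (Pi\<^sub>M UNIV (\<lambda>_. P))))"
  defines "V \<equiv> \<lambda>\<omega>. (norm (gradient (moreau_envelope lam f) (extrapolated \<beta> (\<lambda>k. x k \<omega>) (\<kappa> \<omega>))))\<^sup>2"
  shows "integrable M V"
    and "ereal (\<integral>\<omega>. V \<omega> \<partial>M) \<le> ereal (2 * (1 / lam) / (2 * (1 / lam) - 3 * \<rho>))
      * ((ereal (1 + 2 * \<alpha>\<^sub>0\<^sup>2 / lam\<^sup>2) * optimality_gap f x\<^sub>0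
          + ereal ((1 + 8 * \<alpha>\<^sub>0 / lam) * \<sigma>\<^sup>2 * \<alpha>\<^sub>0\<^sup>2 / (2 * lam))) / ereal (\<alpha>\<^sub>0 * sqrt (real K + 1)))"
proof -
  define W where "W j \<omega> = (norm (grad_env (xbar (nat j) \<omega>)))\<^sup>2" for j :: int and \<omega>
  let ?B = "vimage_algebra (space M) (\<lambda>\<omega> k. S k \<omega>) (Pi\<^sub>M UNIV (\<lambda>_. P))"
  have VW: "V \<omega> = W (\<kappa> \<omega>) \<omega>" if "\<omega> \<in> space M" for \<omega>
    using that by (simp add: V_def W_def gradient_moreau extrapolated_eq_xbar)
  have "S i \<in> ?B \<rightarrow>\<^sub>M P" for i
    using S_measurable_vimage[of i UNIV] by (simp add: restrict_UNIV)
  then have [measurable]: "x k \<in> borel_measurable ?B" "z_prev k \<in> borel_measurable ?B" for k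
    using iterates_measurable[of ?B k] by auto
  have "grad_env \<in> borel_measurable borel"
    by (intro borel_measurable_continuous_onI continuous_on_norm_lipschitz[OF grad_env_lipschitz])
  note [measurable] = this
  have meas: "W j \<in> borel_measurable ?B" for j
    unfolding W_def[abs_def] xbar_def by measurable
  have int: "integrable M (W j)" for j
    using grad_env_sq_integrable unfolding W_def[abs_def] sq_integrable_def by blast
  note rand = M.expectation_at_random_index[OF _ _ \<kappa> distr indep _ meas int]
  have "integrable M (\<lambda>\<omega>. W (\<kappa> \<omega>) \<omega>)" by (rule rand) auto
  then show "integrable M V"
    by (subst Bochner_Integration.integrable_cong[OF refl VW]) auto
  have "{-1 .. int K - 1} = insert (-1) (int ` {..<K})"
    by (auto simp: image_iff Bex_def intro: exI[where x = "nat _"]) presburger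
  then have sumW: "(\<Sum>j\<in>{-1 .. int K - 1}. \<integral>\<omega>. W j \<omega> \<partial>M) = env_grad_sq 0 + (\<Sum>k<K. env_grad_sq k)"
    by (simp add: sum.insert image_iff sum.reindex W_def env_grad_sq_def)
  have "(\<integral>\<omega>. V \<omega> \<partial>M) = (\<integral>\<omega>. W (\<kappa> \<omega>) \<omega> \<partial>M)"
    by (rule Bochner_Integration.integral_cong[OF refl VW])
  also have "\<dots> = (\<Sum>j\<in>{-1 .. int K - 1}. \<integral>\<omega>. W j \<omega> \<partial>M) / real (card {-1 .. int K - 1})"
    by (rule rand) auto
  also have "\<dots> = (env_grad_sq 0 + (\<Sum>k<K. env_grad_sq k)) / (real K + 1)"
    unfolding sumW by simp
  finally have V: "(\<integral>\<omega>. V \<omega> \<partial>M) = (env_grad_sq 0 + (\<Sum>k<K. env_grad_sq k)) / (real K + 1)" .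
  have c: "0 < 2 * (1 / lam) / (2 * (1 / lam) - 3 * \<rho>)"
    using L lam by (intro divide_pos_pos) auto
  show "ereal (\<integral>\<omega>. V \<omega> \<partial>M) \<le> ereal (2 * (1 / lam) / (2 * (1 / lam) - 3 * \<rho>))
      * ((ereal (1 + 2 * \<alpha>\<^sub>0\<^sup>2 / lam\<^sup>2) * optimality_gap f x\<^sub>0
          + ereal ((1 + 8 * \<alpha>\<^sub>0 / lam) * \<sigma>\<^sup>2 * \<alpha>\<^sub>0\<^sup>2 / (2 * lam))) / ereal (\<alpha>\<^sub>0 * sqrt (real K + 1)))"
  proof (rule ereal_bound_by_gap[OF _ c])
    fix m assume m: "\<And>v. m \<le> f v"
    let ?n = "\<alpha>\<^sub>0 * sqrt (real K + 1)"
    have n: "0 < ?n" using alpha0 by simp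
    have "sqrt (real K + 1) * sqrt (real K + 1) = real K + 1" by simp
    then have "(\<integral>\<omega>. V \<omega> \<partial>M) * ?n = \<alpha>\<^sub>0 * \<beta> * (env_grad_sq 0 + (\<Sum>k<K. env_grad_sq k))"
      unfolding V \<beta> by (simp add: divide_simps)
    also note gradient_sum_bound[OF m L step \<beta>]
    finally have "(\<integral>\<omega>. V \<omega> \<partial>M) * ?n \<le> 2 * (1 / lam) / (2 * (1 / lam) - 3 * \<rho>)
        * ((1 + 2 * \<alpha>\<^sub>0\<^sup>2 / lam\<^sup>2) * (f x\<^sub>0 - m)
          + (1 + 8 * \<alpha>\<^sub>0 / lam) * \<sigma>\<^sup>2 * \<alpha>\<^sub>0\<^sup>2 / (2 * lam))" .
    moreover have "X \<le> c * (R / ?n)" if "X * ?n \<le> c * R" for X c R :: real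
      using that n by (simp add: pos_le_divide_eq)
    ultimately show "(\<integral>\<omega>. V \<omega> \<partial>M) \<le> 2 * (1 / lam) / (2 * (1 / lam) - 3 * \<rho>)
        * (((1 + 2 * \<alpha>\<^sub>0\<^sup>2 / lam\<^sup>2) * (f x\<^sub>0 - m)
          + (1 + 8 * \<alpha>\<^sub>0 / lam) * \<sigma>\<^sup>2 * \<alpha>\<^sub>0\<^sup>2 / (2 * lam)) / ?n)"
      by blast
  qed (use alpha0 in \<open>auto intro: add_pos_nonneg\<close>)
qed

end

theorem theorem3:
  fixes P :: "'s measure" and M :: "'w measure"
    and \<phi> :: "real ^ 'n \<Rightarrow> 's \<Rightarrow> real"
    and f :: "real ^ 'n \<Rightarrow> real"
    and f' :: "real ^ 'n \<Rightarrow> 's \<Rightarrow> real ^ 'n"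
    and S :: "nat \<Rightarrow> 'w \<Rightarrow> 's"
    and x z g :: "nat \<Rightarrow> 'w \<Rightarrow> real ^ 'n"
    and x\<^sub>0 :: "real ^ 'n"
    and kstar :: "'w \<Rightarrow> int"
    and K :: nat
    and \<rho> \<sigma> lam \<alpha>\<^sub>0 \<alpha> \<nu> \<beta> c :: real
  assumes P: "prob_space P"
    and \<phi>_integrable: "\<And>u. integrable P (\<phi> u)"
    and f_def: "\<And>u. f u = (\<integral>s. \<phi> u s \<partial>P)"
    and rho: "\<rho> > 0"
    and smooth: "smooth_fun \<rho> f"
    and f'_measurable: "(\<lambda>(u, s). f' u s) \<in> borel_measurable (borel \<Otimes>\<^sub>M P)"
    and f'_subgradient:
      "\<And>u s. s \<in> space P \<Longrightarrow> f' u s \<in> frechet_subdifferential (\<lambda>v. \<phi> v s) u"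
    and A1: "\<And>u. integrable P (f' u)" "\<And>u. (\<integral>s. f' u s \<partial>P) = gradient f u"
    and sigma: "\<sigma> > 0"
    and A3: "\<And>u. integrable P (\<lambda>s. (norm (f' u s - gradient f u))\<^sup>2)"
      "\<And>u. (\<integral>s. (norm (f' u s - gradient f u))\<^sup>2 \<partial>P) \<le> \<sigma>\<^sup>2"
    and lambda: "1 / lam \<in> {3 * \<rho> / 2 <.. 2 * \<rho>}"
    and alpha0: "\<alpha>\<^sub>0 \<in> {0 <.. 1 / (4 * \<rho>)}"
    and alpha: "\<alpha> = \<alpha>\<^sub>0 / sqrt (real K + 1)"
    and nu: "\<nu> = 1 / \<alpha>\<^sub>0"
    and beta: "\<beta> = \<nu> * \<alpha>"
    and M: "prob_space M"
    and S_indep: "prob_space.indep_vars M (\<lambda>_. P) S UNIV"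
    and S_distr: "\<And>k. distr M P (S k) = P"
    and g: "\<And>k \<omega>. \<omega> \<in> space M \<Longrightarrow> g k \<omega> = f' (x k \<omega>) (S k \<omega>)"
    and x_0: "\<And>\<omega>. \<omega> \<in> space M \<Longrightarrow> x 0 \<omega> = x\<^sub>0"
    and z_0: "\<And>\<omega>. \<omega> \<in> space M \<Longrightarrow> z 0 \<omega> = g 0 \<omega>"
    and x_Suc: "\<And>k \<omega>. \<omega> \<in> space M \<Longrightarrow> x (Suc k) \<omega> = x k \<omega> - \<alpha> *\<^sub>R z k \<omega>"
    and z_Suc: "\<And>k \<omega>. \<omega> \<in> space M \<Longrightarrow>
      z (Suc k) \<omega> = \<beta> *\<^sub>R g (Suc k) \<omega> + (1 - \<beta>) *\<^sub>R ((x k \<omega> - x (Suc k) \<omega>) /\<^sub>R \<alpha>)"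
    and kstar_measurable: "kstar \<in> M \<rightarrow>\<^sub>M count_space UNIV"
    and kstar_distr:
      "distr M (count_space UNIV) kstar = measure_pmf (pmf_of_set {-1 .. int K - 1})"
    and kstar_indep:
      "prob_space.indep_set M
         (sets (vimage_algebra (space M) kstar (count_space UNIV)))
         (sets (vimage_algebra (space M) (\<lambda>\<omega> k. S k \<omega>) (Pi\<^sub>M UNIV (\<lambda>_. P))))"
    and c: "c = 2 * (1 / lam) / (2 * (1 / lam) - 3 * \<rho>)"
  defines "G \<equiv> \<lambda>\<mu> \<omega>.
      (norm (gradient (moreau_envelope \<mu> f) (extrapolated \<beta> (\<lambda>k. x k \<omega>) (kstar \<omega>))))\<^sup>2"
    and "\<Delta> \<equiv> optimality_gap f x\<^sub>0"
  shows "integrable M (G lam) \<and>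
      ereal (\<integral>\<omega>. G lam \<omega> \<partial>M)
        \<le> ereal c * ((ereal (1 + 2 * \<alpha>\<^sub>0\<^sup>2 / lam\<^sup>2) * \<Delta>
              + ereal ((1 + 8 * \<alpha>\<^sub>0 / lam) * \<sigma>\<^sup>2 * \<alpha>\<^sub>0\<^sup>2 / (2 * lam)))
            / ereal (\<alpha>\<^sub>0 * sqrt (real K + 1))) \<and>
    integrable M (G (1 / (2 * \<rho>))) \<and>
      ereal (\<integral>\<omega>. G (1 / (2 * \<rho>)) \<omega> \<partial>M)
        \<le> 4 * ((ereal (1 + 8 * \<rho>\<^sup>2 * \<alpha>\<^sub>0\<^sup>2) * \<Delta>
              + ereal ((\<rho> + 16 * \<alpha>\<^sub>0 * \<rho>\<^sup>2) * \<sigma>\<^sup>2 * \<alpha>\<^sub>0\<^sup>2))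
            / ereal (\<alpha>\<^sub>0 * sqrt (real K + 1)))"
proof -
  interpret P: prob_space P by (rule P)
  interpret M: prob_space M by (rule M)
  have alpha0': "0 < \<alpha>\<^sub>0" "\<alpha>\<^sub>0 \<le> 1 / (4 * \<rho>)" using alpha0 by auto
  have sq: "0 < sqrt (real K + 1)" "1 \<le> sqrt (real K + 1)" by simp_all
  have \<beta>: "\<beta> = 1 / sqrt (real K + 1)" using beta nu alpha alpha0' by simp
  have \<beta>01: "0 < \<beta>" "\<beta> \<le> 1" unfolding \<beta> using sq by (simp_all add: divide_simps)
  have \<alpha>: "\<alpha> = \<alpha>\<^sub>0 * \<beta>" using alpha \<beta> by simp
  have \<alpha>_pos: "0 < \<alpha>" unfolding \<alpha> using alpha0' \<beta>01 by simp
  have iter: "heavy_ball f \<rho> P M f' S x z x\<^sub>0 \<sigma> \<alpha>\<^sub>0 \<beta>"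
  proof unfold_locales
    show "z (Suc k) \<omega> = \<beta> *\<^sub>R f' (x (Suc k) \<omega>) (S (Suc k) \<omega>) + (1 - \<beta>) *\<^sub>R z k \<omega>"
      if "\<omega> \<in> space M" for k \<omega>
      using z_Suc[OF that, of k] x_Suc[OF that, of k] g[OF that, of "Suc k"] \<alpha>_pos by simp
  qed (use rho smooth f'_measurable A1 A3 S_indep S_distr x_0 x_Suc z_0 g \<alpha> alpha0' \<beta>01 in auto)
  have bound: "integrable M (G \<mu>) \<and> ereal (\<integral>\<omega>. G \<mu> \<omega> \<partial>M)
      \<le> ereal (2 * (1 / \<mu>) / (2 * (1 / \<mu>) - 3 * \<rho>))
        * ((ereal (1 + 2 * \<alpha>\<^sub>0\<^sup>2 / \<mu>\<^sup>2) * \<Delta>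
          + ereal ((1 + 8 * \<alpha>\<^sub>0 / \<mu>) * \<sigma>\<^sup>2 * \<alpha>\<^sub>0\<^sup>2 / (2 * \<mu>))) / ereal (\<alpha>\<^sub>0 * sqrt (real K + 1)))"
    if \<mu>: "3 * \<rho> / 2 < 1 / \<mu>" "1 / \<mu> \<le> 2 * \<rho>" for \<mu>
  proof -
    have "0 < 1 / \<mu>" using \<mu>(1) rho by (rule_tac less_trans[of _ "3 * \<rho> / 2"]) auto
    then have \<mu>0: "0 < \<mu>" by simp
    have "\<rho> < 1 / \<mu>" using \<mu>(1) rho by linarith
    then have "\<rho> * \<mu> < 1" using \<mu>0 by (simp add: field_simps)
    with \<mu>0 have "heavy_ball_moreau f' S x z x\<^sub>0 \<sigma> \<alpha>\<^sub>0 \<beta> \<mu> f \<rho> P M"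
      using iter rho smooth
      by (intro heavy_ball_moreau.intro smooth_moreau.intro smooth_objective.intro smooth_moreau_axioms.intro) auto
    from heavy_ball_moreau.random_iterate_bound[OF this \<mu> alpha0'(2) \<beta> kstar_measurable kstar_distr kstar_indep]
    show ?thesis unfolding G_def \<Delta>_def by blast
  qed
  have first: "3 * \<rho> / 2 < 1 / lam" "1 / lam \<le> 2 * \<rho>" using lambda by auto
  have half: "1 / (1 / (2 * \<rho>)) = 2 * \<rho>" by simp
  have second: "3 * \<rho> / 2 < 1 / (1 / (2 * \<rho>))" "1 / (1 / (2 * \<rho>)) \<le> 2 * \<rho>"
    unfolding half using rho by auto
  have simps: "2 * (1 / (1 / (2 * \<rho>))) / (2 * (1 / (1 / (2 * \<rho>))) - 3 * \<rho>) = 4"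
    "1 + 2 * \<alpha>\<^sub>0\<^sup>2 / (1 / (2 * \<rho>))\<^sup>2 = 1 + 8 * \<rho>\<^sup>2 * \<alpha>\<^sub>0\<^sup>2"
    "(1 + 8 * \<alpha>\<^sub>0 / (1 / (2 * \<rho>))) * \<sigma>\<^sup>2 * \<alpha>\<^sub>0\<^sup>2 / (2 * (1 / (2 * \<rho>)))
      = (\<rho> + 16 * \<alpha>\<^sub>0 * \<rho>\<^sup>2) * \<sigma>\<^sup>2 * \<alpha>\<^sub>0\<^sup>2"
    using rho by (simp_all add: power2_eq_square algebra_simps)
  show ?thesis
    using bound[OF first] bound[OF second] unfolding c simps by simp
qed

end
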